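(* Let $d\ge2$ and $0<\alpha<1$. Almost surely, $$\mathcal H^{(d-1)\alpha}\bigl(\overline{X(S^{d-1})}\bigr)<\infty ;$$ in particular, $\mathcal H^{(d-1)\alpha}(F_\alpha)<\infty$ almost surely.
   Context: $S^{d-1}$ is the unit sphere of $\mathbb R^d$. Let $\tau_1,\tau_2,\dots$ be independent standard exponential random variables, $\Gamma_k=\tau_1+\cdots+\tau_k$, and let $\varepsilon_1,\varepsilon_2,\dots$ be independent random points of $S^{d-1}$, each with the uniform (rotation-invariant) probability law, independent of $(\tau_k)$. Put $\gamma_k=\Gamma_k^{-1/\alpha}$; since $0<\alpha<1$, $\sum_k\gamma_k<\infty$ almost surely. $Z_\alpha=\bigoplus_{k\ge1}\gamma_k[0,\varepsilon_k]$ is the almost sure limit in the Hausdorff metric of the partial Minkowski sums $\bigoplus_{k\le n}\gamma_k[0,\varepsilon_k]$, where $[0,x]=\{sx:0\le s\le1\}$, and $F_\alpha=\operatorname{ext}Z_\alpha$ is its set of extreme points. The random field $X$ is $$X(u)=\sum_{k=1}^{\infty}\gamma_k\varepsilon_k\mathbf 1_{\{\langle u,\varepsilon_k\rangle>0\}},\qquad u\in S^{d-1},$$ which almost surely converges absolutely and uniformly in $u$; $X(S^{d-1})$ is its image and the bar denotes closure in $\mathbb R^d$. The Hausdorff measure is $\mathcal H^s(A)=\lim_{\delta\downarrow0}\inf\{\sum_j(\operatorname{diam}U_j)^s: A\subset\bigcup_jU_j,\ \varnothing\neq U_j\subset\mathbb R^d,\ \operatorname{diam}U_j\le\delta\}$,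 the infimum being over countable families. *)

theory Defs
  imports "HOL-Probability.Probability" "HOL-Library.Set_Algebras"
begin

text \<open>
  Covers are countable (finite or infinite) families, indexed by a set of naturals.
  Boundedness is stated explicitly because \<^const>\<open>diameter\<close> is unspecified on unbounded sets.
  As \<^prop>\<open>0 powr s = (0::real)\<close> also for \<^prop>\<open>s = 0\<close>, the definition is meant for \<^prop>\<open>s > 0\<close>.
\<close>

definition hausdorff_premeasure :: "real \<Rightarrow> real \<Rightarrow> 'a::metric_space set \<Rightarrow> ennreal" where
  "hausdorff_premeasure s \<delta> A =
     (INF (J, U) \<in> {(J :: nat set, U :: nat \<Rightarrow> 'a set).
         A \<subseteq> (\<Union>j\<in>J. U j) \<and> (\<forall>j\<in>J. U j \<noteq> {} \<and> bounded (U j) \<and> diameter (U j) \<le> \<delta>)}.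
       \<Sum>\<^sub>\<infinity>j\<in>J. ennreal (diameter (U j) powr s))"

definition hausdorff_measure :: "real \<Rightarrow> 'a::metric_space set \<Rightarrow> ennreal" where
  "hausdorff_measure s A = Lim (at_right 0) (\<lambda>\<delta>. hausdorff_premeasure s \<delta> A)"

lemma hausdorff_premeasure_antimono:
  assumes "\<delta> \<le> \<delta>'"
  shows "hausdorff_premeasure s \<delta>' A \<le> hausdorff_premeasure s \<delta> A"
  unfolding hausdorff_premeasure_def
  by (rule INF_superset_mono) (use assms in \<open>force+\<close>)

lemma hausdorff_premeasure_tendsto:
  "((\<lambda>\<delta>. hausdorff_premeasure s \<delta> A) \<longlongrightarrow> (SUP \<delta>\<in>{0<..}. hausdorff_premeasure s \<delta> A)) (at_right 0)"
proof (rule increasing_tendsto)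
  show "\<forall>\<^sub>F \<delta> in at_right 0.
      hausdorff_premeasure s \<delta> A \<le> (SUP \<delta>\<in>{0<..}. hausdorff_premeasure s \<delta> A)"
    using eventually_at_right_less[of 0] by eventually_elim (auto intro: SUP_upper)
next
  fix x assume "x < (SUP \<delta>\<in>{0<..}. hausdorff_premeasure s \<delta> A)"
  then obtain d where d: "d > 0" "x < hausdorff_premeasure s d A"
    by (auto simp: less_SUP_iff)
  have "\<forall>\<^sub>F \<delta> in at_right 0. \<delta> < d"
    using d(1) by (auto simp: eventually_at_right)
  then show "\<forall>\<^sub>F \<delta> in at_right 0. x < hausdorff_premeasure s \<delta> A"
    by eventually_elim
      (use d(2) hausdorff_premeasure_antimono in \<open>meson less_imp_le less_le_trans\<close>)
qed

lemma hausdorff_measure_eq_SUP: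
  "hausdorff_measure s A = (SUP \<delta>\<in>{0<..}. hausdorff_premeasure s \<delta> A)"
  unfolding hausdorff_measure_def
  by (intro tendsto_Lim hausdorff_premeasure_tendsto) simp

text \<open>Only meaningful for nonempty bounded sets.\<close>

definition hausdorff_dist :: "'a::metric_space set \<Rightarrow> 'a set \<Rightarrow> real" where
  "hausdorff_dist A B = max (SUP a\<in>A. infdist a B) (SUP b\<in>B. infdist b A)"

text \<open>
  The uniform law as the rotation-invariant probability law carried by the unit sphere;
  invariance is required under the full orthogonal group.
\<close>

definition uniform_on_unit_sphere :: "'a::euclidean_space measure \<Rightarrow> bool" where
  "uniform_on_unit_sphere N \<longleftrightarrow>
     prob_space N \<and> sets N = sets borel \<and> emeasure N (sphere 0 1) = 1 \<and>
     (\<forall>f. orthogonal_transformation f \<longrightarrow> distr N borel f = N)"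

text \<open>
  The functions below act on individual realisations \<open>t\<close> of $(\tau_k)$ and \<open>e\<close> of $(\varepsilon_k)$.
  Sequences are indexed from \<open>0\<close>: \<open>t k\<close> stands for $\tau_{k+1}$, and so on.
\<close>

definition Gamma_seq :: "(nat \<Rightarrow> real) \<Rightarrow> nat \<Rightarrow> real" where
  "Gamma_seq t k = (\<Sum>i\<le>k. t i)"

definition gamma_seq :: "real \<Rightarrow> (nat \<Rightarrow> real) \<Rightarrow> nat \<Rightarrow> real" where
  "gamma_seq \<alpha> t k = Gamma_seq t k powr (- 1 / \<alpha>)"

text \<open>
  The series and the limit set are unspecified for realisations without convergence;
  under the intended laws these form a null set.
\<close>

definition X_field ::
    "real \<Rightarrow> (nat \<Rightarrow> real) \<Rightarrow> (nat \<Rightarrow> 'a::euclidean_space) \<Rightarrow> 'a \<Rightarrow> 'a" where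
  "X_field \<alpha> t e u = (\<Sum>k. indicat_real {v. u \<bullet> v > 0} (e k) *\<^sub>R gamma_seq \<alpha> t k *\<^sub>R e k)"

text \<open>The sum is the Minkowski sum of sets from \<^theory>\<open>HOL-Library.Set_Algebras\<close>.\<close>

definition partial_zonotope ::
    "real \<Rightarrow> (nat \<Rightarrow> real) \<Rightarrow> (nat \<Rightarrow> 'a::euclidean_space) \<Rightarrow> nat \<Rightarrow> 'a set" where
  "partial_zonotope \<alpha> t e n = (\<Sum>k<n. (*\<^sub>R) (gamma_seq \<alpha> t k) ` closed_segment 0 (e k))"

definition Z_zonoid ::
    "real \<Rightarrow> (nat \<Rightarrow> real) \<Rightarrow> (nat \<Rightarrow> 'a::euclidean_space) \<Rightarrow> 'a set" where
  "Z_zonoid \<alpha> t e =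
     (THE Z. Z \<noteq> {} \<and> compact Z \<and> (\<lambda>n. hausdorff_dist (partial_zonotope \<alpha> t e n) Z) \<longlonglongrightarrow> 0)"

lemma partial_zonotope_compact_nonempty:
  "compact (partial_zonotope \<alpha> t e n)" "partial_zonotope \<alpha> t e n \<noteq> {}"
proof (induction n)
  case 0
  { case 1 show ?case by (simp add: partial_zonotope_def set_zero) }
  { case 2 show ?case by (simp add: partial_zonotope_def set_zero) }
next
  case (Suc n)
  have eq: "partial_zonotope \<alpha> t e (Suc n) =
      partial_zonotope \<alpha> t e n + (*\<^sub>R) (gamma_seq \<alpha> t n) ` closed_segment 0 (e n)"
    by (simp add: partial_zonotope_def)
  have seg: "compact ((*\<^sub>R) (gamma_seq \<alpha> t n) ` closed_segment 0 (e n))"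
    by (intro compact_scaling compact_segment)
  { case 1 show ?case
      using compact_sums[OF Suc.IH(1) seg] unfolding eq set_plus_def
      by (rule back_subst[of compact]) blast }
  { case 2 show ?case
      using Suc.IH(2) unfolding eq set_plus_def by auto }
qed

lemma hausdorff_dist_ge:
  assumes "bounded A" "bounded B" "A \<noteq> {}" "B \<noteq> {}"
  shows "a \<in> A \<Longrightarrow> infdist a B \<le> hausdorff_dist A B"
    and "b \<in> B \<Longrightarrow> infdist b A \<le> hausdorff_dist A B"
proof -
  have *: "bdd_above ((\<lambda>a. infdist a B) ` A)" if AB: "bounded A" "B \<noteq> {}" for A B :: "'a set"
  proof -
    from AB obtain z where z: "z \<in> B" by blast
    obtain r where "\<forall>a\<in>A. dist z a \<le> r"
      using AB(1) bounded_any_center by metis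
    then show ?thesis
      using z by (intro bdd_aboveI2[of _ _ r]) (metis dist_commute infdist_le order_trans)
  qed
  show "a \<in> A \<Longrightarrow> infdist a B \<le> hausdorff_dist A B"
    unfolding hausdorff_dist_def using *[of A B] assms by (intro max.coboundedI1 cSUP_upper) auto
  show "b \<in> B \<Longrightarrow> infdist b A \<le> hausdorff_dist A B"
    unfolding hausdorff_dist_def using *[of B A] assms by (intro max.coboundedI2 cSUP_upper) auto
qed

lemma hausdorff_limit_subset:
  fixes Z Z' :: "'a::euclidean_space set"
  assumes P: "\<And>n. compact (P n)" "\<And>n. P n \<noteq> {}"
    and Z: "compact Z" "Z \<noteq> {}" "(\<lambda>n. hausdorff_dist (P n) Z) \<longlonglongrightarrow> 0"
    and Z': "compact Z'" "Z' \<noteq> {}" "(\<lambda>n. hausdorff_dist (P n) Z') \<longlonglongrightarrow> 0"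
  shows "Z \<subseteq> Z'"
proof
  fix x assume x: "x \<in> Z"
  have "infdist x Z' \<le> hausdorff_dist (P n) Z + hausdorff_dist (P n) Z'" for n
  proof -
    obtain p where p: "p \<in> P n" "infdist x (P n) = dist x p"
      using infdist_attains_inf[OF compact_imp_closed[OF P(1)] P(2), of n x] by metis
    have "infdist x Z' \<le> infdist p Z' + dist x p"
      by (rule infdist_triangle)
    moreover have "infdist p Z' \<le> hausdorff_dist (P n) Z'"
      using P Z' p(1) by (intro hausdorff_dist_ge(1) compact_imp_bounded)
    moreover have "dist x p \<le> hausdorff_dist (P n) Z"
      unfolding p(2)[symmetric] using P Z x by (intro hausdorff_dist_ge(2) compact_imp_bounded)
    ultimately show ?thesis by linarith
  qed
  then have "infdist x Z' \<le> 0"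
    using LIMSEQ_le_const[OF tendsto_add[OF Z(3) Z'(3)], of "infdist x Z'"] by simp
  then have "infdist x Z' = 0"
    using infdist_nonneg[of x Z'] by linarith
  then show "x \<in> Z'"
    using in_closed_iff_infdist_zero[OF compact_imp_closed[OF Z'(1)] Z'(2)] by simp
qed

lemma Z_zonoid_eqI:
  assumes "Z \<noteq> {}" "compact Z" "(\<lambda>n. hausdorff_dist (partial_zonotope \<alpha> t e n) Z) \<longlonglongrightarrow> 0"
  shows "Z_zonoid \<alpha> t e = Z"
  unfolding Z_zonoid_def
proof (rule the_equality)
  show "Z' = Z"
    if "Z' \<noteq> {} \<and> compact Z' \<and> (\<lambda>n. hausdorff_dist (partial_zonotope \<alpha> t e n) Z') \<longlonglongrightarrow> 0" for Z'
    using that assms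
    by (intro equalityI hausdorff_limit_subset[of "partial_zonotope \<alpha> t e"]
        partial_zonotope_compact_nonempty) auto
qed (use assms in simp)

definition F_extreme ::
    "real \<Rightarrow> (nat \<Rightarrow> real) \<Rightarrow> (nat \<Rightarrow> 'a::euclidean_space) \<Rightarrow> 'a set" where
  "F_extreme \<alpha> t e = {x. x extreme_point_of Z_zonoid \<alpha> t e}"

end

theory Submission
  imports Defs
begin

text \<open>
  Write \<open>d\<close> for the dimension and \<open>s = (d - 1) * \<alpha>\<close>. For each \<open>n\<close> the set of directions is covered by
  of order \<open>n ^ (d - 1)\<close> cells of diameter of order \<open>1 / n\<close>, and the image of \<open>X\<close> is covered accordingly.
  Inside the cell around \<open>v\<close>, the term of index \<open>k\<close> in the series changes only if the hyperplane
  orthogonal to \<open>e k\<close> meets the cell. This forces \<open>e k\<close> into a slab around the hyperplane orthogonal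
  to \<open>v\<close>, an event of probability of order \<open>1 / n\<close> (\<open>uniform_on_unit_sphere_slab\<close>). The crossing
  hyperplanes of index \<open>k < n\<close>, of which there is typically a bounded number \<open>m\<close>, cut the cell into at
  most \<open>2 ^ m\<close> pieces. On each piece \<open>X\<close> oscillates at most by the sum of the crossing jumps of index
  \<open>k \<ge> n\<close>. Almost surely the jumps are bounded by a multiple of \<open>(k + 1)\<close> to the power \<open>- 1 / \<alpha>\<close>
  (\<open>AE_gamma_seq_power_bound\<close>), so this sum is of order \<open>n\<close> to the power \<open>- 1 / \<alpha>\<close>. The sum of the
  \<open>s\<close>-th powers of the diameters is thus of order \<open>n ^ (d - 1)\<close> times \<open>n\<close> to the power \<open>- s / \<alpha>\<close>,
  that is, of order 1.

  To make this rigorous, the number of pieces and the power of the diameter are both bounded by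
  exponentials of weighted counts of crossing hyperplanes. Together they give the exponential of a
  single weighted sum of independent indicators, the \<open>crossing_load\<close> of the cell
  (\<open>hausdorff_premeasure_closure_X_le\<close>), whose expectation factorises and is bounded uniformly in \<open>n\<close>
  and \<open>v\<close> (\<open>nn_integral_exp_crossing_load\<close>). By Fatou's lemma the lower limit of the sums over all cells
  is almost surely finite, and the Hausdorff measure needs good covers only along a subsequence.

  For the extreme points, \<open>u \<bullet> X u\<close> is the support function of the zonoid in direction \<open>u\<close>. Hence the
  zonoid is the convex hull of the closed image of \<open>X\<close> (\<open>Z_zonoid_eq_hull\<close>), and its extreme points lie
  in that closed image.
\<close>

section \<open>Upper bounds for Hausdorff measures\<close>

text \<open>
  The covers in the premeasure are indexed by naturals and have no empty members; a finite cover
  indexed by an arbitrary type is brought into this form by discarding its empty members and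
  enumerating the rest.
\<close>

lemma hausdorff_premeasure_le_finite_cover:
  assumes fin: "finite I" and cover: "A \<subseteq> (\<Union>i\<in>I. U i)"
    and U: "\<And>i. i \<in> I \<Longrightarrow> bounded (U i)" "\<And>i. i \<in> I \<Longrightarrow> diameter (U i) \<le> \<delta>"
  shows "hausdorff_premeasure s \<delta> A \<le> (\<Sum>i\<in>I. ennreal (diameter (U i) powr s))"
proof -
  define I' where "I' = {i \<in> I. U i \<noteq> {}}"
  have fin': "finite I'" using fin by (simp add: I'_def)
  obtain h where h: "bij_betw h {..<card I'} I'"
    using ex_bij_betw_nat_finite[OF fin'] by (auto simp: atLeast0LessThan)
  have hI: "h j \<in> I" "U (h j) \<noteq> {}" if "j < card I'" for j
    using bij_betwE[OF h] that by (auto simp: I'_def)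
  have "hausdorff_premeasure s \<delta> A
      \<le> (\<Sum>\<^sub>\<infinity>j\<in>{..<card I'}. ennreal (diameter (U (h j)) powr s))"
    unfolding hausdorff_premeasure_def
  proof (rule INF_lower2)
    have "A \<subseteq> (\<Union>i\<in>I'. U i)"
    proof
      fix x assume "x \<in> A"
      with cover obtain i where "i \<in> I" "x \<in> U i" by blast
      then show "x \<in> (\<Union>i\<in>I'. U i)" by (intro UN_I[of i]) (auto simp: I'_def)
    qed
    also have "\<dots> = (\<Union>j<card I'. U (h j))"
      using bij_betw_imp_surj_on[OF h] by (metis image_image)
    finally show "({..<card I'}, \<lambda>j. U (h j)) \<in> {(J :: nat set, U).
         A \<subseteq> (\<Union>j\<in>J. U j) \<and> (\<forall>j\<in>J. U j \<noteq> {} \<and> bounded (U j) \<and> diameter (U j) \<le> \<delta>)}"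
      using hI U by auto
  qed simp
  also have "\<dots> = (\<Sum>j<card I'. ennreal (diameter (U (h j)) powr s))"
    by simp
  also have "\<dots> = (\<Sum>i\<in>I'. ennreal (diameter (U i) powr s))"
    by (rule sum.reindex_bij_betw[OF h])
  also have "\<dots> \<le> (\<Sum>i\<in>I. ennreal (diameter (U i) powr s))"
    by (rule sum_mono2) (auto simp: I'_def fin)
  finally show ?thesis .
qed

lemma hausdorff_measure_mono:
  assumes "A \<subseteq> B"
  shows "hausdorff_measure s A \<le> hausdorff_measure s B"
  unfolding hausdorff_measure_eq_SUP hausdorff_premeasure_def
  by (intro SUP_mono' INF_superset_mono) (use assms in auto)

section \<open>The zonoid as a convex hull\<close>

lemma convex_scaled_segment_sum: "convex (\<Sum>k\<in>I. (*\<^sub>R) (g k) ` closed_segment 0 (e k))"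
  by (intro convex_set_sum convex_scaling) simp

lemma inner_scaled_segment_le:
  assumes "x \<in> (*\<^sub>R) c ` closed_segment 0 (v::'a::real_inner)" "0 \<le> c"
  shows "u \<bullet> x \<le> c * max 0 (u \<bullet> v)"
proof -
  obtain s where s: "0 \<le> s" "s \<le> 1" "x = c *\<^sub>R s *\<^sub>R v"
    using assms(1) by (auto simp: closed_segment_def)
  have "s * (u \<bullet> v) \<le> max 0 (u \<bullet> v)"
  proof -
    have "s * (u \<bullet> v) \<le> s * max 0 (u \<bullet> v)"
      by (rule mult_left_mono) (use s in auto)
    also have "\<dots> \<le> max 0 (u \<bullet> v)"
      by (rule mult_left_le_one_le) (use s in auto)
    finally show ?thesis .
  qed
  then show ?thesis
    using s(3) mult_left_mono[OF _ assms(2), of "s * (u \<bullet> v)" "max 0 (u \<bullet> v)"] by (simp add: mult.assoc)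
qed

text \<open>
  In direction \<open>u\<close> each segment contributes at most its positive part, so the right-hand side bounds the
  support function of the partial zonotope.
\<close>

lemma inner_partial_zonotope_le:
  assumes "x \<in> partial_zonotope \<alpha> t e n" "\<And>k. 0 \<le> gamma_seq \<alpha> t k"
  shows "u \<bullet> x \<le> (\<Sum>k<n. gamma_seq \<alpha> t k * max 0 (u \<bullet> e k))"
  using assms(1)
proof (induction n arbitrary: x)
  case 0 then show ?case by (simp add: partial_zonotope_def)
next
  case (Suc n)
  then obtain y z where "y \<in> partial_zonotope \<alpha> t e n" "x = y + z"
    "z \<in> (*\<^sub>R) (gamma_seq \<alpha> t n) ` closed_segment 0 (e n)"
    by (auto simp: partial_zonotope_def elim!: set_plus_elim)
  then show ?case
    using Suc.IH[of y] inner_scaled_segment_le[of z _ "e n" u] assms(2)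
    by (simp add: inner_add_right add_mono)
qed

lemma sum_selected_in_partial_zonotope:
  "(\<Sum>k<n. indicat_real V (e k) *\<^sub>R gamma_seq \<alpha> t k *\<^sub>R e k) \<in> partial_zonotope \<alpha> t e n"
  unfolding partial_zonotope_def
proof (induction n)
  case (Suc n)
  have "indicat_real V (e n) *\<^sub>R gamma_seq \<alpha> t n *\<^sub>R e n
      \<in> (*\<^sub>R) (gamma_seq \<alpha> t n) ` closed_segment 0 (e n)"
    by (rule image_eqI[where x="indicat_real V (e n) *\<^sub>R e n"]) (auto simp: indicator_def)
  with Suc show ?case
    by (simp add: set_plus_intro)
qed simp

lemma X_field_scale: "0 < c \<Longrightarrow> X_field \<alpha> t e (c *\<^sub>R u) = X_field \<alpha> t e u"
  by (simp add: X_field_def zero_less_mult_iff)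

context
  fixes \<alpha> :: real and t :: "nat \<Rightarrow> real" and e :: "nat \<Rightarrow> 'a::euclidean_space"
  assumes summable_gamma: "summable (gamma_seq \<alpha> t)"
    and gamma_nonneg: "\<And>k. 0 \<le> gamma_seq \<alpha> t k"
    and norm_e: "\<And>k. norm (e k) = 1"
begin

lemma summable_X_field_terms:
  "summable (\<lambda>k. indicat_real V (e k) *\<^sub>R gamma_seq \<alpha> t k *\<^sub>R e k)"
  by (rule summable_comparison_test'[OF summable_gamma, of 0])
    (auto simp: norm_e gamma_nonneg indicator_def)

lemma norm_X_field_le: "norm (X_field \<alpha> t e u) \<le> suminf (gamma_seq \<alpha> t)"
  unfolding X_field_def
  by (rule norm_suminf_le[OF _ summable_gamma])
     (auto simp: norm_e gamma_nonneg indicator_def)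

lemma compact_closure_X_field: "compact (closure (X_field \<alpha> t e ` S))"
  using norm_X_field_le by (auto simp: compact_closure bounded_iff)

text \<open>
  If a point \<open>x\<close> of a partial zonotope were outside the hull, it could be separated from it by some
  direction \<open>u\<close>. But \<open>X u\<close> collects exactly the vectors with positive inner product with \<open>u\<close>, so
  \<open>u \<bullet> X u\<close> is the sum of all positive parts and no partial zonotope reaches beyond it.
\<close>

lemma partial_zonotope_subset_hull:
  "partial_zonotope \<alpha> t e n \<subseteq> convex hull (closure (X_field \<alpha> t e ` sphere 0 1))" (is "_ \<subseteq> ?W")
proof
  fix x assume x: "x \<in> partial_zonotope \<alpha> t e n"
  show "x \<in> ?W"
  proof (rule ccontr)
    assume "x \<notin> ?W"
    moreover have "closed ?W"
      by (intro compact_imp_closed compact_convex_hull compact_closure_X_field)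
    ultimately obtain a b where ab: "a \<bullet> x < b" "\<And>y. y \<in> ?W \<Longrightarrow> b < a \<bullet> y"
      using separating_hyperplane_closed_point[of ?W x] by auto
    obtain w :: 'a where w: "norm w = 1" using vector_choose_size[of 1] by auto
    have in_W: "X_field \<alpha> t e v \<in> ?W" if "norm v = 1" for v
      using that closure_subset[of "X_field \<alpha> t e ` sphere 0 1"] by (intro hull_inc) auto
    have "a \<noteq> 0"
      using ab(1) ab(2)[OF in_W[OF w]] by auto
    \<comment> \<open>The hull is on the large side of \<open>a\<close>, so \<open>- a\<close> is a direction in which \<open>x\<close> sticks out of it.\<close>
    define u where "u = - a"
    have "u \<noteq> 0" using \<open>a \<noteq> 0\<close> by (simp add: u_def)
    have "X_field \<alpha> t e u = X_field \<alpha> t e ((1 / norm u) *\<^sub>R u)"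
      by (rule X_field_scale[symmetric]) (use \<open>u \<noteq> 0\<close> in auto)
    then have "X_field \<alpha> t e u \<in> ?W"
      using in_W[of "(1 / norm u) *\<^sub>R u"] \<open>u \<noteq> 0\<close> by simp
    then have "u \<bullet> X_field \<alpha> t e u < u \<bullet> x"
      using ab(1) ab(2)[of "X_field \<alpha> t e u"] by (simp add: u_def)
    moreover have "u \<bullet> X_field \<alpha> t e u = (\<Sum>k. gamma_seq \<alpha> t k * max 0 (u \<bullet> e k))"
    proof -
      have "u \<bullet> X_field \<alpha> t e u = (\<Sum>k. u \<bullet> (indicat_real {v. 0 < u \<bullet> v} (e k) *\<^sub>R gamma_seq \<alpha> t k *\<^sub>R e k))"
        unfolding X_field_def
        by (rule bounded_linear.suminf[OF bounded_linear_inner_right summable_X_field_terms])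
      also have "\<dots> = (\<Sum>k. gamma_seq \<alpha> t k * max 0 (u \<bullet> e k))"
        by (intro suminf_cong) (auto simp: indicator_def max_def)
      finally show ?thesis .
    qed
    moreover have "(\<Sum>k<n. gamma_seq \<alpha> t k * max 0 (u \<bullet> e k)) \<le> (\<Sum>k. gamma_seq \<alpha> t k * max 0 (u \<bullet> e k))"
    proof (rule sum_le_suminf)
      show "summable (\<lambda>k. gamma_seq \<alpha> t k * max 0 (u \<bullet> e k))"
      proof (rule summable_comparison_test'[OF summable_mult2[OF summable_gamma, of "norm u"], of 0])
        fix k
        have "\<bar>max 0 (u \<bullet> e k)\<bar> \<le> norm u"
          using norm_cauchy_schwarz[of u "e k"] by (simp add: norm_e)
        then show "norm (gamma_seq \<alpha> t k * max 0 (u \<bullet> e k)) \<le> gamma_seq \<alpha> t k * norm u"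
          by (simp add: abs_mult gamma_nonneg mult_left_mono)
      qed
    qed (auto simp: gamma_nonneg)
    ultimately show False
      using inner_partial_zonotope_le[OF x gamma_nonneg, of u] by linarith
  qed
qed

text \<open>
  The partial sum lies in the partial zonotope, so this bounds the distance from
  \<open>X u\<close> to that zonotope uniformly in \<open>u\<close>.
\<close>

lemma X_field_partial_sum_dist:
  "norm (X_field \<alpha> t e u - (\<Sum>k<n. indicat_real {v. u \<bullet> v > 0} (e k) *\<^sub>R gamma_seq \<alpha> t k *\<^sub>R e k))
    \<le> (\<Sum>k. gamma_seq \<alpha> t (k + n))"
proof -
  have "X_field \<alpha> t e u - (\<Sum>k<n. indicat_real {v. u \<bullet> v > 0} (e k) *\<^sub>R gamma_seq \<alpha> t k *\<^sub>R e k)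
     = (\<Sum>k. indicat_real {v. u \<bullet> v > 0} (e (k + n)) *\<^sub>R gamma_seq \<alpha> t (k + n) *\<^sub>R e (k + n))"
    unfolding X_field_def
    by (rule suminf_minus_initial_segment[OF summable_X_field_terms, symmetric])
  also have "norm \<dots> \<le> (\<Sum>k. gamma_seq \<alpha> t (k + n))"
    by (rule norm_suminf_le[OF _ summable_ignore_initial_segment[OF summable_gamma]])
      (auto simp: norm_e gamma_nonneg indicator_def)
  finally show ?thesis .
qed

text \<open>
  The partial zonotopes lie in the hull. Conversely the hull is the smallest closed convex set
  containing the image of \<open>X\<close>, and the closed neighbourhood of a partial zonotope whose radius is
  the tail sum is such a set. So the Hausdorff distance is at most the tail sum.
\<close>

lemma Z_zonoid_eq_hull:
  "Z_zonoid \<alpha> t e = convex hull (closure (X_field \<alpha> t e ` sphere 0 1))" (is "_ = ?W")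
proof (rule Z_zonoid_eqI)
  let ?P = "partial_zonotope \<alpha> t e"
  let ?r = "\<lambda>n. \<Sum>k. gamma_seq \<alpha> t (k + n)"
  obtain w :: 'a where w: "norm w = 1" using vector_choose_size[of 1] by auto
  show ne: "?W \<noteq> {}"
    using w by (auto simp: closure_eq_empty)
  show "compact ?W"
    by (intro compact_convex_hull compact_closure_X_field)
  have r_nonneg: "0 \<le> ?r n" for n
    by (intro suminf_nonneg summable_ignore_initial_segment summable_gamma gamma_nonneg)
  have le: "hausdorff_dist (?P n) ?W \<le> ?r n" for n
  proof -
    have close: "convex (?P n + cball 0 (?r n))" "closed (?P n + cball 0 (?r n))"
    proof -
      show "convex (?P n + cball 0 (?r n))"
        unfolding partial_zonotope_def
        by (intro convex_set_plus convex_scaled_segment_sum convex_cball)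
      have "compact {x + y |x y. x \<in> ?P n \<and> y \<in> cball 0 (?r n)}"
        by (intro compact_sums partial_zonotope_compact_nonempty compact_cball)
      also have "{x + y |x y. x \<in> ?P n \<and> y \<in> cball 0 (?r n)} = ?P n + cball 0 (?r n)"
        unfolding set_plus_def by blast
      finally show "closed (?P n + cball 0 (?r n))"
        by (rule compact_imp_closed)
    qed
    have "X_field \<alpha> t e ` sphere 0 1 \<subseteq> ?P n + cball 0 (?r n)"
    proof clarify
      fix u
      let ?p = "\<Sum>k<n. indicat_real {v. u \<bullet> v > 0} (e k) *\<^sub>R gamma_seq \<alpha> t k *\<^sub>R e k"
      have "?p + (X_field \<alpha> t e u - ?p) \<in> ?P n + cball 0 (?r n)"
        using X_field_partial_sum_dist[of u n] sum_selected_in_partial_zonotope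
        by (intro set_plus_intro) auto
      then show "X_field \<alpha> t e u \<in> ?P n + cball 0 (?r n)" by simp
    qed
    then have "?W \<subseteq> ?P n + cball 0 (?r n)"
      by (intro hull_minimal closure_minimal close)
    then have "infdist x (?P n) \<le> ?r n" if "x \<in> ?W" for x
    proof -
      have "x \<in> ?P n + cball 0 (?r n)"
        using that \<open>?W \<subseteq> _\<close> by blast
      then obtain p y where "p \<in> ?P n" "norm y \<le> ?r n" "x = p + y"
        by (auto elim: set_plus_elim)
      then show ?thesis
        using infdist_le[of p "?P n" x] by (simp add: dist_norm)
    qed
    then have "(SUP x\<in>?W. infdist x (?P n)) \<le> ?r n"
      using ne by (intro cSUP_least) auto
    moreover have "(SUP p\<in>?P n. infdist p ?W) \<le> ?r n"
    proof (rule cSUP_least)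
      show "infdist p ?W \<le> ?r n" if "p \<in> ?P n" for p
        using subsetD[OF partial_zonotope_subset_hull that] r_nonneg[of n] by simp
    qed (rule partial_zonotope_compact_nonempty)
    ultimately show ?thesis by (simp add: hausdorff_dist_def)
  qed
  have "0 \<le> hausdorff_dist (?P n) ?W" for n
  proof -
    obtain p where "p \<in> ?P n" using partial_zonotope_compact_nonempty(2) by blast
    then have "infdist p ?W \<le> hausdorff_dist (?P n) ?W"
      using ne by (intro hausdorff_dist_ge compact_imp_bounded partial_zonotope_compact_nonempty
          compact_convex_hull compact_closure_X_field)
    then show ?thesis by (rule order_trans[OF infdist_nonneg])
  qed
  then show "(\<lambda>n. hausdorff_dist (?P n) ?W) \<longlonglongrightarrow> 0"
    by (rule tendsto_sandwich[OF eventuallyI eventuallyI[OF le] tendsto_const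
          suminf_exist_split2[OF summable_gamma]])
qed

lemma F_extreme_subset_closure: "F_extreme \<alpha> t e \<subseteq> closure (X_field \<alpha> t e ` sphere 0 1)"
  unfolding F_extreme_def Z_zonoid_eq_hull by (auto dest: extreme_point_of_convex_hull)

end

section \<open>Slabs under the uniform law\<close>

definition slab :: "'a::euclidean_space \<Rightarrow> real \<Rightarrow> 'a set" where
  "slab v r = {x. \<bar>v \<bullet> x\<bar> \<le> r}"

lemma closed_slab: "closed (slab v r)"
  unfolding slab_def by (intro closed_Collect_le continuous_intros)

lemma slab_measurable [measurable]: "slab v r \<in> sets borel"
  by (simp add: closed_slab borel_closed)

text \<open>
  About \<open>1 / (3 r)\<close> translates of the slab piece in steps of \<open>3 r\<close> along \<open>x\<close> are disjoint and stay in
  the ball of radius 2, so the volume of one piece is at most of order \<open>r\<close>. The bound is stated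
  relative to the volume of the unit ball, which cancels in the application.
\<close>

lemma emeasure_cball_slab_le:
  fixes x :: "'a::euclidean_space"
  assumes x: "norm x = 1" and r: "0 < r"
  shows "emeasure lborel (cball 0 1 \<inter> slab x r) \<le> ennreal (6 * 2 ^ DIM('a) * r * measure lborel (cball (0::'a) 1))"
proof -
  let ?S = "cball 0 1 \<inter> slab x r"
  let ?B = "cball (0::'a) 1"
  have lm: "?S \<in> lmeasurable"
    by (intro lmeasurable_compact compact_Int_closed compact_cball closed_slab)
  have em: "emeasure lborel ?S = ennreal (measure lebesgue ?S)"
  proof -
    have "?S \<in> sets lborel"
      by (simp add: closed_slab borel_closed closed_Int)
    then have "emeasure lborel ?S = emeasure lebesgue ?S"
      by simp
    also have "\<dots> = ennreal (measure lebesgue ?S)"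
      by (rule emeasure_eq_measure2[OF lm])
    finally show ?thesis .
  qed
  have "measure lebesgue ?S \<le> 6 * 2 ^ DIM('a) * r * measure lebesgue ?B"
  proof (cases "r \<le> 1 / 3")
    case False
    have "measure lebesgue ?S \<le> measure lebesgue ?B"
      by (intro measure_mono_fmeasurable fmeasurableD lm) auto
    also have "1 * measure lebesgue ?B \<le> 6 * 2 ^ DIM('a) * r * measure lebesgue ?B"
    proof (rule mult_right_mono)
      have "1 * 1 \<le> 2 ^ DIM('a) * (6 * r)"
        using False by (intro mult_mono) auto
      then show "1 \<le> 6 * 2 ^ DIM('a) * r" by (simp add: mult_ac)
    qed simp
    finally show ?thesis by simp
  next
    case True
    define K where "K = nat \<lfloor>1 / (3 * r)\<rfloor>"
    have K: "real K \<le> 1 / (3 * r)" "1 \<le> real K" "1 / (3 * r) \<le> real K + 1"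
    proof -
      have "1 \<le> 1 / (3 * r)" using r True by (simp add: field_simps)
      then have "1 \<le> \<lfloor>1 / (3 * r)\<rfloor>" by simp
      then have "real K = of_int \<lfloor>1 / (3 * r)\<rfloor>" unfolding K_def by (intro of_nat_nat) linarith
      then show "real K \<le> 1 / (3 * r)" "1 \<le> real K" "1 / (3 * r) \<le> real K + 1"
        using \<open>1 \<le> \<lfloor>1 / (3 * r)\<rfloor>\<close> by linarith+
    qed
    define T where "T k = (+) ((3 * r * real k) *\<^sub>R x) ` ?S" for k
    have T_lm: "T k \<in> lmeasurable" and T_eq: "measure lebesgue (T k) = measure lebesgue ?S" for k
      unfolding T_def using lm by (auto simp: measurable_translation measure_translation)
    have T_slab: "\<bar>x \<bullet> y - 3 * r * real k\<bar> \<le> r" if "y \<in> T k" for y k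
      using that x by (auto simp: T_def slab_def inner_add_right dot_square_norm)
    have disj: "disjoint_family_on T {..<K}"
      unfolding disjoint_family_on_def
    proof (intro ballI impI equals0I)
      fix k l y assume "k \<noteq> l" "y \<in> T k \<inter> T l"
      then have "\<bar>3 * r * real k - 3 * r * real l\<bar> \<le> 2 * r"
        using T_slab[of y k] T_slab[of y l] by auto
      also have "3 * r * real k - 3 * r * real l = 3 * r * (real k - real l)"
        by (simp add: algebra_simps)
      finally have "3 * \<bar>real k - real l\<bar> \<le> 2"
        using r by (simp add: abs_mult)
      moreover have "1 \<le> \<bar>real k - real l\<bar>"
        using \<open>k \<noteq> l\<close> by (cases k l rule: linorder_cases) auto
      moreover have "\<not> (3 * z \<le> 2 \<and> 1 \<le> z)" for z :: real by auto
      ultimately show False by blast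
    qed
    have "real K * measure lebesgue ?S = (\<Sum>k<K. measure lebesgue (T k))"
      by (simp add: T_eq)
    also have "\<dots> = measure lebesgue (\<Union>k<K. T k)"
    proof (rule measure_finite_Union[symmetric])
      show "T ` {..<K} \<subseteq> sets lebesgue" using T_lm by auto
      show "emeasure lebesgue (T k) \<noteq> \<infinity>" for k 
        using fmeasurableD2[OF T_lm[of k]] by (simp only: infinity_ennreal_def not_False_eq_True)
    qed (use disj in auto)
    also have "\<dots> \<le> measure lebesgue (cball (0::'a) 2)"
    proof (rule measure_mono_fmeasurable)
      show "(\<Union>k<K. T k) \<subseteq> cball 0 2"
      proof
        fix y assume "y \<in> (\<Union>k<K. T k)"
        then obtain k z where kz: "k < K" "norm z \<le> 1" "y = (3 * r * real k) *\<^sub>R x + z"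
          by (auto simp: T_def)
        have "3 * r * real k \<le> 3 * r * real K" using kz r by simp
        also have "\<dots> \<le> 1" using K(1) r by (simp add: field_simps)
        finally have "norm ((3 * r * real k) *\<^sub>R x) \<le> 1" using r x by simp
        then show "y \<in> cball 0 2"
          using norm_triangle_ineq[of "(3 * r * real k) *\<^sub>R x" z] kz by simp
      qed
      show "(\<Union>k<K. T k) \<in> sets lebesgue" using T_lm by auto
    qed simp
    also have "\<dots> = 2 ^ DIM('a) * measure lebesgue ?B"
      by (simp add: content_cball)
    finally have K_le: "real K * measure lebesgue ?S \<le> 2 ^ DIM('a) * measure lebesgue ?B" .
    have "measure lebesgue ?S \<le> 6 * r * (real K * measure lebesgue ?S)"
    proof -
      have "1 / (3 * r) \<le> 2 * real K" using K by linarith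
      then have "1 \<le> 6 * r * real K" using r by (simp add: field_simps)
      then have "1 * measure lebesgue ?S \<le> 6 * r * real K * measure lebesgue ?S"
        by (intro mult_right_mono) auto
      then show ?thesis by (simp add: mult_ac)
    qed
    also have "\<dots> \<le> 6 * r * (2 ^ DIM('a) * measure lebesgue ?B)"
      using K_le r by (intro mult_left_mono) auto
    finally show ?thesis by (simp add: mult_ac)
  qed
  then show ?thesis unfolding em by (intro ennreal_leI) simp
qed

text \<open>
  By rotation invariance the probability of \<open>slab w r\<close> is the same for all unit vectors \<open>w\<close>, and it
  can only grow when \<open>w\<close> is shortened. Averaging over all \<open>u\<close> in the unit ball with respect to
  Lebesgue measure therefore bounds it by the mean probability of \<open>slab u r\<close>; exchanging the
  integrals turns this into the volume of a slab piece of the ball.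
  Vectors of norm greater than 1 give thinner slabs.
\<close>

lemma uniform_on_unit_sphere_slab:
  fixes N :: "(real ^ 'd) measure"
  assumes N: "uniform_on_unit_sphere N" and v: "1 \<le> norm v" and r: "0 < r"
  shows "measure N (slab v r) \<le> 6 * 2 ^ CARD('d) * r"
proof -
  interpret N: prob_space N using N by (simp add: uniform_on_unit_sphere_def)
  let ?B = "cball (0::real^'d) 1"
  have sets_N [measurable_cong]: "sets N = sets borel" and
    inv: "\<And>f. orthogonal_transformation f \<Longrightarrow> distr N borel f = N"
    using N by (auto simp: uniform_on_unit_sphere_def)
  have sp_N: "space N = UNIV" using sets_eq_imp_space_eq[OF sets_N] by simp
  have rot: "emeasure N (slab u r) = emeasure N (slab w r)" if "norm u = 1" "norm w = 1" for u w
  proof -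
    obtain f where f: "orthogonal_transformation f" "f u = w"
      using orthogonal_transformation_exists_1[of u w] \<open>norm u = 1\<close> \<open>norm w = 1\<close> by blast
    have [measurable]: "f \<in> borel_measurable borel"
      using f(1) by (intro borel_measurable_continuous_onI linear_continuous_on)
        (simp add: orthogonal_transformation linear_conv_bounded_linear)
    have "emeasure N (slab w r) = emeasure (distr N borel f) (slab w r)" by (simp add: inv f)
    also have "\<dots> = emeasure N (f -` slab w r)"
      by (subst emeasure_distr) (auto simp: sp_N)
    also have "f -` slab w r = slab u r"
      using f by (auto simp: slab_def orthogonal_transformation_def)
    finally show ?thesis ..
  qed
  define w where "w = v /\<^sub>R norm v"
  have w: "norm w = 1"
  proof -
    have "norm v \<noteq> 0" using v by linarith
    then show ?thesis by (simp add: w_def)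
  qed
  have scale: "slab (y /\<^sub>R norm y) r \<subseteq> slab y r" if "norm y \<le> 1" "y \<noteq> 0" for y :: "real^'d"
  proof
    fix x assume "x \<in> slab (y /\<^sub>R norm y) r"
    then have "\<bar>y \<bullet> x\<bar> \<le> r * norm y" using that by (simp add: slab_def divide_simps abs_mult)
    also have "\<dots> \<le> r" using that r by (simp add: mult_left_le)
    finally show "x \<in> slab y r" by (simp add: slab_def)
  qed
  have "slab v r \<subseteq> slab w r"
  proof
    fix x assume x: "x \<in> slab v r"
    have "\<bar>v \<bullet> x\<bar> / norm v \<le> \<bar>v \<bullet> x\<bar> / 1" using v by (intro divide_left_mono) auto
    then show "x \<in> slab w r" using x by (simp add: slab_def w_def abs_mult divide_inverse mult.commute)
  qed
  then have 1: "emeasure N (slab v r) \<le> emeasure N (slab w r)"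
    by (intro emeasure_mono) auto
  have meas: "(\<lambda>(u, x). indicator (?B \<inter> slab x r) u :: ennreal) \<in> borel_measurable (lborel \<Otimes>\<^sub>M N)"
  proof -
    let ?C = "{p::(real^'d) \<times> (real^'d). norm (fst p) \<le> 1 \<and> \<bar>snd p \<bullet> fst p\<bar> \<le> r}"
    have "closed ?C"
      by (intro closed_Collect_conj closed_Collect_le continuous_intros)
    then have "?C \<in> sets (borel \<Otimes>\<^sub>M borel)"
      unfolding borel_prod by (rule borel_closed)
    also have "sets (borel \<Otimes>\<^sub>M borel) = sets ((lborel :: (real^'d) measure) \<Otimes>\<^sub>M N)"
      by (intro sets_pair_measure_cong) (simp_all add: sets_N)
    finally have "(indicator ?C :: _ \<Rightarrow> ennreal) \<in> borel_measurable (lborel \<Otimes>\<^sub>M N)"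
      by (rule borel_measurable_indicator)
    also have "indicator ?C = (\<lambda>(u, x). indicator (?B \<inter> slab x r) u :: ennreal)"
      by (auto simp: slab_def indicator_def fun_eq_iff)
    finally show ?thesis .
  qed
  \<comment> \<open>Fubini's theorem for the set of pairs \<open>(u, x)\<close> with \<open>u\<close> in the ball and \<open>x\<close> in \<open>slab u r\<close>; the condition is
    symmetric, so it also says that \<open>u\<close> is in \<open>slab x r\<close>.\<close>
  have "emeasure N (slab w r) * emeasure lborel ?B = (\<integral>\<^sup>+u. emeasure N (slab w r) * indicator ?B u \<partial>lborel)"
    by (simp add: nn_integral_cmult_indicator)
  also have "\<dots> \<le> (\<integral>\<^sup>+u. (\<integral>\<^sup>+x. indicator (?B \<inter> slab x r) u \<partial>N) \<partial>lborel)"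
  proof (rule nn_integral_mono)
    fix u :: "real^'d"
    have "emeasure N (slab w r) \<le> emeasure N (slab u r)" if "u \<in> ?B"
    proof (cases "u = 0")
      case True
      then have "slab u r = UNIV" using r by (auto simp: slab_def)
      then have "emeasure N (slab u r) = 1"
        using N.emeasure_space_1 by (simp add: sp_N)
      then show ?thesis by (simp add: N.emeasure_eq_measure)
    next
      case False
      have "emeasure N (slab w r) = emeasure N (slab (u /\<^sub>R norm u) r)"
        using False w by (intro rot) auto
      also have "\<dots> \<le> emeasure N (slab u r)"
        using scale[of u] that False by (intro emeasure_mono) auto
      finally show ?thesis .
    qed
    moreover have "(\<integral>\<^sup>+x. indicator (?B \<inter> slab x r) u \<partial>N) = emeasure N (slab u r)" if "u \<in> ?B"
    proof -
      have "(\<integral>\<^sup>+x. indicator (?B \<inter> slab x r) u \<partial>N) = (\<integral>\<^sup>+x. indicator (slab u r) x \<partial>N)"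
        using that by (intro nn_integral_cong) (auto simp: indicator_def slab_def inner_commute)
      then show ?thesis by simp
    qed
    ultimately show "emeasure N (slab w r) * indicator ?B u \<le> (\<integral>\<^sup>+x. indicator (?B \<inter> slab x r) u \<partial>N)"
      by (auto simp: indicator_def)
  qed
  also have "\<dots> = (\<integral>\<^sup>+x. (\<integral>\<^sup>+u. indicator (?B \<inter> slab x r) u \<partial>lborel) \<partial>N)"
  proof -
    interpret pair_sigma_finite lborel N
      by (intro pair_sigma_finite.intro lborel.sigma_finite_measure_axioms N.sigma_finite_measure_axioms)
    show ?thesis
      by (rule Fubini'[symmetric]) (rule meas)
  qed
  also have "\<dots> = (\<integral>\<^sup>+x. emeasure lborel (?B \<inter> slab x r) \<partial>N)"
    by simp
  also have "\<dots> \<le> (\<integral>\<^sup>+x. ennreal (6 * 2 ^ CARD('d) * r * measure lborel ?B) \<partial>N)"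
  proof (rule nn_integral_mono_AE)
    have "AE x in N. x \<in> sphere 0 1"
      using N by (intro N.AE_in_set_eq_1[THEN iffD2]) (auto simp: uniform_on_unit_sphere_def N.emeasure_eq_measure)
    then show "AE x in N. emeasure lborel (?B \<inter> slab x r) \<le> ennreal (6 * 2 ^ CARD('d) * r * measure lborel ?B)"
      by eventually_elim (use emeasure_cball_slab_le[where 'a="real^'d"] r in auto)
  qed
  also have "\<dots> = ennreal (6 * 2 ^ CARD('d) * r * measure lborel ?B)"
    by (simp add: N.emeasure_space_1)
  finally have 2: "emeasure N (slab w r) * emeasure lborel ?B \<le> ennreal (6 * 2 ^ CARD('d) * r * measure lborel ?B)" .
  have B: "emeasure lborel ?B = ennreal (measure lborel ?B)"
    by (intro emeasure_eq_ennreal_measure) (use emeasure_lborel_cball_finite[of 0 1] in \<open>simp add: less_top\<close>)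
  have pos: "measure lborel ?B > 0"
    using content_cball_pos[of 1 "0::real^'d"] by simp
  have "measure N (slab w r) * measure lborel ?B \<le> 6 * 2 ^ CARD('d) * r * measure lborel ?B"
    using 2 r unfolding B by (simp add: N.emeasure_eq_measure ennreal_mult[symmetric])
  then have "measure N (slab w r) \<le> 6 * 2 ^ CARD('d) * r"
    using pos by simp
  moreover have "measure N (slab v r) \<le> measure N (slab w r)"
    using 1 by (simp add: N.emeasure_eq_measure)
  ultimately show ?thesis by simp
qed

section \<open>Exponential moments of weighted counts\<close>

text \<open>
  For \<open>k \<ge> n\<close> this is \<open>(k + 1)\<close> to the power \<open>- 1 / \<alpha>\<close>, the almost sure order of the jump
  \<open>gamma_seq \<alpha> t k\<close>, in units of the order of jump \<open>n\<close>. The larger jumps, with \<open>k < n\<close>, get weight 1: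
  they are not measured, only counted.
\<close>

definition crossing_weight :: "real \<Rightarrow> nat \<Rightarrow> nat \<Rightarrow> real" where
  "crossing_weight \<alpha> n k = min 1 ((real n / real (Suc k)) powr (1 / \<alpha>))"

lemma crossing_weight_bounds: "0 \<le> crossing_weight \<alpha> n k" "crossing_weight \<alpha> n k \<le> 1"
  by (auto simp: crossing_weight_def)

lemma crossing_weight_early:
  assumes "0 < \<alpha>" "k < n" shows "crossing_weight \<alpha> n k = 1"
proof -
  have "1 powr (1 / \<alpha>) \<le> (real n / real (Suc k)) powr (1 / \<alpha>)"
    using assms by (intro powr_mono2) (auto simp: field_simps)
  then show ?thesis by (simp add: crossing_weight_def)
qed

lemma crossing_weight_late:
  assumes "0 < \<alpha>" "n \<le> k" shows "crossing_weight \<alpha> n k = real n powr (1 / \<alpha>) * real (Suc k) powr (- 1 / \<alpha>)"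
proof -
  have "(real n / real (Suc k)) powr (1 / \<alpha>) \<le> 1 powr (1 / \<alpha>)"
    using assms by (intro powr_mono2) (auto simp: field_simps)
  then have "crossing_weight \<alpha> n k = real n powr (1 / \<alpha>) / real (Suc k) powr (1 / \<alpha>)"
    unfolding crossing_weight_def by (subst powr_divide[symmetric]) auto
  also have "\<dots> = real n powr (1 / \<alpha>) * real (Suc k) powr - (1 / \<alpha>)"
    by (simp only: powr_minus divide_inverse)
  finally show ?thesis by simp
qed

text \<open>
  Comparison of a term of the series with the integral over \<open>{x..x + 1}\<close>, by the mean value theorem.
\<close>

lemma powr_telescoping_bound:
  fixes \<beta> :: real
  assumes "1 < \<beta>" "0 < x"
  shows "(\<beta> - 1) * (x + 1) powr - \<beta> \<le> x powr (1 - \<beta>) - (x + 1) powr (1 - \<beta>)"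
proof -
  have "\<exists>z>x. z < x + 1 \<and> (x + 1) powr (1 - \<beta>) - x powr (1 - \<beta>)
      = (x + 1 - x) * ((1 - \<beta>) * z powr - \<beta>)"
  proof (rule MVT2)
    fix y assume "x \<le> y"
    then show "DERIV (\<lambda>y. y powr (1 - \<beta>)) y :> (1 - \<beta>) * y powr - \<beta>"
      using has_real_derivative_powr[of y "1 - \<beta>"] assms by simp
  qed simp
  then obtain z where z: "x < z" "z < x + 1"
    "(x + 1) powr (1 - \<beta>) - x powr (1 - \<beta>) = (1 - \<beta>) * z powr - \<beta>" by auto
  have "(x + 1) powr - \<beta> \<le> z powr - \<beta>"
    using z assms by (intro powr_mono2') auto
  then have "(\<beta> - 1) * (x + 1) powr - \<beta> \<le> (\<beta> - 1) * z powr - \<beta>"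
    using assms by (intro mult_left_mono) auto
  then show ?thesis using z(3) by (simp add: algebra_simps)
qed

text \<open>
  The first \<open>n\<close> weights add up to \<open>n\<close>, and the later ones to at most \<open>n * \<alpha> / (1 - \<alpha>)\<close> by comparison
  with an integral. Linearity in \<open>n\<close> balances the probability of order \<open>1 / n\<close> of a slab.
\<close>

lemma sum_crossing_weight_le:
  assumes \<alpha>: "0 < \<alpha>" "\<alpha> < 1" and n: "0 < n"
  shows "(\<Sum>k<N. crossing_weight \<alpha> n k) \<le> real n / (1 - \<alpha>)"
proof -
  define \<beta> where "\<beta> = 1 / \<alpha>"
  have \<beta>: "1 < \<beta>" using \<alpha> by (simp add: \<beta>_def)
  define G where "G N = real n powr \<beta> / (\<beta> - 1) * (real n powr (1 - \<beta>) - real N powr (1 - \<beta>))" for N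
  have step: "(\<Sum>k<N. crossing_weight \<alpha> n k) \<le> real n + G N" if "n \<le> N" for N
    using that
  proof (induction N rule: dec_induct)
    case base
    have "(\<Sum>k<n. crossing_weight \<alpha> n k) \<le> (\<Sum>k<n. 1)"
      by (intro sum_mono crossing_weight_bounds)
    then show ?case by (simp add: G_def)
  next
    case (step N)
    have "real n powr \<beta> / (\<beta> - 1) * ((\<beta> - 1) * (real N + 1) powr - \<beta>)
        \<le> real n powr \<beta> / (\<beta> - 1) * (real N powr (1 - \<beta>) - (real N + 1) powr (1 - \<beta>))"
      using n step.hyps \<beta> by (intro mult_left_mono powr_telescoping_bound) auto
    also have "\<dots> = G (Suc N) - G N"
      by (simp add: G_def right_diff_distrib add.commute)
    also have "real n powr \<beta> / (\<beta> - 1) * ((\<beta> - 1) * (real N + 1) powr - \<beta>) = crossing_weight \<alpha> n N"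
      using \<beta> crossing_weight_late[OF \<alpha>(1), of n N] step.hyps
      by (simp add: add.commute flip: \<beta>_def)
    finally have "crossing_weight \<alpha> n N \<le> G (Suc N) - G N" .
    then show ?case using step.IH by simp
  qed
  have "(\<Sum>k<N. crossing_weight \<alpha> n k) \<le> (\<Sum>k<max n N. crossing_weight \<alpha> n k)"
    by (intro sum_mono2) (auto simp: crossing_weight_bounds)
  also have "\<dots> \<le> real n + G (max n N)"
    by (rule step) simp
  also have "G (max n N) \<le> real n powr \<beta> / (\<beta> - 1) * real n powr (1 - \<beta>)"
    unfolding G_def using \<beta> by (intro mult_left_mono) auto
  also have "\<dots> = real n / (\<beta> - 1)"
    using n by (simp flip: powr_add)
  also have "real n + real n / (\<beta> - 1) = real n / (1 - \<alpha>)"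
    using \<alpha> by (simp add: \<beta>_def field_simps)
  finally show ?thesis by simp
qed

lemma summable_crossing_weight:
  assumes "0 < \<alpha>" "\<alpha> < 1" "0 < n"
  shows "summable (crossing_weight \<alpha> n)"
proof (rule bounded_imp_summable)
  show "(\<Sum>k\<le>N. crossing_weight \<alpha> n k) \<le> real n / (1 - \<alpha>)" for N
    using sum_crossing_weight_le[OF assms, of "Suc N"] by (simp only: lessThan_Suc_atMost)
qed (rule crossing_weight_bounds)

text \<open>
  By independence the exponential moment of a finite weighted count is a product. As \<open>exp w \<le> 1 + 2 * w\<close>
  on the unit interval, its factors are at most \<open>1 + 2 * w k * p \<le> exp (2 * p * w k)\<close>. Fatou's lemma
  passes to the infinite sum.
\<close>

lemma (in prob_space) nn_integral_exp_weighted_hits: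
  fixes X :: "nat \<Rightarrow> 'a \<Rightarrow> 'b::euclidean_space"
  assumes indep: "indep_vars (\<lambda>_. borel) X UNIV" and A [measurable]: "A \<in> sets borel"
    and p: "\<And>k. prob {\<omega> \<in> space M. X k \<omega> \<in> A} \<le> p"
    and w: "\<And>k. 0 \<le> w k" "\<And>k. w k \<le> 1" "summable w" "suminf w \<le> W"
  shows "(\<integral>\<^sup>+\<omega>. ennreal (exp (\<Sum>k. w k * indicat_real A (X k \<omega>))) \<partial>M) \<le> ennreal (exp (2 * p * W))"
proof -
  have X [measurable]: "X k \<in> borel_measurable M" for k
    using indep by (simp add: indep_vars_def)
  have p0: "0 \<le> p" using p[of 0] measure_nonneg order_trans by blast
  have single: "(\<integral>\<^sup>+\<omega>. ennreal (exp (w k * indicat_real A (X k \<omega>))) \<partial>M) \<le> ennreal (exp (2 * p * w k))" for k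
  proof -
    have "exp (w k) \<le> 1 + 2 * w k"
      using exp_bound[OF w(1,2)[of k]] mult_left_le[OF w(2,1)[of k]] by (simp add: power2_eq_square)
    then have "(\<integral>\<^sup>+\<omega>. ennreal (exp (w k * indicat_real A (X k \<omega>))) \<partial>M)
        \<le> (\<integral>\<^sup>+\<omega>. 1 + ennreal (2 * w k) * indicator {\<omega> \<in> space M. X k \<omega> \<in> A} \<omega> \<partial>M)"
      using w(1)[of k] ennreal_leI[of "exp (w k)" "1 + 2 * w k"]
      by (intro nn_integral_mono) (auto simp: indicator_def ennreal_plus)
    also have "\<dots> = 1 + ennreal (2 * w k) * emeasure M {\<omega> \<in> space M. X k \<omega> \<in> A}"
      by (subst nn_integral_add) (auto simp: nn_integral_cmult_indicator emeasure_space_1)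
    also have "\<dots> = ennreal (1 + 2 * w k * prob {\<omega> \<in> space M. X k \<omega> \<in> A})"
      using w(1)[of k] by (simp add: emeasure_eq_measure ennreal_mult'[symmetric] flip: ennreal_1 ennreal_plus)
    also have "\<dots> \<le> ennreal (1 + 2 * w k * p)"
      using w(1)[of k] p[of k] by (intro ennreal_leI add_left_mono mult_left_mono) auto
    also have "\<dots> \<le> ennreal (exp (2 * p * w k))"
      using exp_ge_add_one_self[of "2 * w k * p"] by (intro ennreal_leI) (simp add: mult_ac)
    finally show ?thesis .
  qed
  have partial: "(\<integral>\<^sup>+\<omega>. ennreal (exp (\<Sum>k<N. w k * indicat_real A (X k \<omega>))) \<partial>M) \<le> ennreal (exp (2 * p * W))" for N
  proof -
    have "(\<integral>\<^sup>+\<omega>. ennreal (exp (\<Sum>k<N. w k * indicat_real A (X k \<omega>))) \<partial>M)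
        = (\<integral>\<^sup>+\<omega>. (\<Prod>k<N. ennreal (exp (w k * indicat_real A (X k \<omega>)))) \<partial>M)"
      by (simp only: exp_sum finite_lessThan prod_ennreal exp_ge_zero)
    also have "\<dots> = (\<Prod>k<N. \<integral>\<^sup>+\<omega>. ennreal (exp (w k * indicat_real A (X k \<omega>))) \<partial>M)"
    proof (rule indep_vars_nn_integral)
      have "indep_vars (\<lambda>_. borel) X {..<N}"
        by (rule indep_vars_subset[OF indep]) simp
      then show "indep_vars (\<lambda>_. borel) (\<lambda>k \<omega>. ennreal (exp (w k * indicat_real A (X k \<omega>)))) {..<N}"
        by (rule indep_vars_compose2) measurable
    qed auto
    also have "\<dots> \<le> (\<Prod>k<N. ennreal (exp (2 * p * w k)))"
      by (induction N) (auto intro!: mult_mono single)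
    also have "\<dots> = ennreal (exp (2 * p * (\<Sum>k<N. w k)))"
      by (simp add: prod_ennreal exp_sum sum_distrib_left)
    also have "\<dots> \<le> ennreal (exp (2 * p * W))"
    proof -
      have "(\<Sum>k<N. w k) \<le> W"
        using sum_le_suminf[OF w(3), of "{..<N}"] w(1,4) by force
      then show ?thesis using p0 by (intro ennreal_leI) (simp add: mult_left_mono)
    qed
    finally show ?thesis .
  qed
  have summ: "summable (\<lambda>k. w k * indicat_real A (X k \<omega>))" for \<omega>
    by (rule summable_comparison_test'[OF w(3), of 0]) (auto simp: indicator_def w(1))
  have "(\<lambda>N. ennreal (exp (\<Sum>k<N. w k * indicat_real A (X k \<omega>))))
      \<longlonglongrightarrow> ennreal (exp (\<Sum>k. w k * indicat_real A (X k \<omega>)))" for \<omega>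
    by (intro tendsto_ennrealI tendsto_exp summable_LIMSEQ summ)
  then have "(\<integral>\<^sup>+\<omega>. ennreal (exp (\<Sum>k. w k * indicat_real A (X k \<omega>))) \<partial>M)
      = (\<integral>\<^sup>+\<omega>. liminf (\<lambda>N. ennreal (exp (\<Sum>k<N. w k * indicat_real A (X k \<omega>)))) \<partial>M)"
    by (intro nn_integral_cong) (metis lim_imp_Liminf sequentially_bot)
  also have "\<dots> \<le> liminf (\<lambda>N. \<integral>\<^sup>+\<omega>. ennreal (exp (\<Sum>k<N. w k * indicat_real A (X k \<omega>))) \<partial>M)"
    by (rule nn_integral_liminf) measurable
  also have "\<dots> \<le> limsup (\<lambda>N. \<integral>\<^sup>+\<omega>. ennreal (exp (\<Sum>k<N. w k * indicat_real A (X k \<omega>))) \<partial>M)"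
    by (rule Liminf_le_Limsup) simp
  also have "\<dots> \<le> ennreal (exp (2 * p * W))"
    by (intro Limsup_bounded always_eventually allI partial)
  finally show ?thesis .
qed

section \<open>A grid of directions\<close>

text \<open>
  The points of mesh \<open>1 / n\<close> on the boundary of the cube of vectors with coordinates in \<open>{-1..1}\<close>; the index \<open>j\<close> and the
  sign \<open>s\<close> choose a face. As the field depends only on the direction of its argument, the surface of
  the cube serves as well as the sphere, and its grid points are easy to count.
\<close>

definition cube_grid :: "nat \<Rightarrow> (real ^ 'd) set" where
  "cube_grid n = (\<Union>j. \<Union>s\<in>{-1, 1}. (\<lambda>f. \<chi> i. if i = j then s else real_of_int (f i) / real n) `
     (\<Pi>\<^sub>E i\<in>UNIV - {j}. {- int n..int n}))"

lemma finite_cube_grid: "finite (cube_grid n)"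
  unfolding cube_grid_def by (intro finite_UN_I finite_imageI finite_PiE) auto

lemma card_cube_grid_le:
  "card (cube_grid n :: (real ^ 'd) set) \<le> 2 * CARD('d) * (2 * n + 1) ^ (CARD('d) - 1)"
proof -
  let ?F = "\<lambda>j::'d. (\<Pi>\<^sub>E i\<in>UNIV - {j}. {- int n..int n})"
  let ?g = "\<lambda>(j::'d) s f. (\<chi> i. if i = j then s else real_of_int (f i) / real n) :: real ^ 'd"
  have "card (?g j s ` ?F j) \<le> (2 * n + 1) ^ (CARD('d) - 1)" for j s
  proof -
    have "card (?g j s ` ?F j) \<le> card (?F j)"
      by (intro card_image_le finite_PiE) auto
    also have "\<dots> = (2 * n + 1) ^ (CARD('d) - 1)"
    proof -
      have "card {- int n..int n} = 2 * n + 1" by (simp add: nat_eq_iff)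
      then show ?thesis by (simp add: card_PiE card_Diff_singleton)
    qed
    finally show ?thesis .
  qed
  then have face: "card (\<Union>s\<in>{-1, 1}. ?g j s ` ?F j) \<le> 2 * (2 * n + 1) ^ (CARD('d) - 1)" for j
    using card_UN_le[of "{-1, 1::real}" "\<lambda>s. ?g j s ` ?F j"] 
      sum_mono[of "{-1, 1::real}" "\<lambda>s. card (?g j s ` ?F j)" "\<lambda>_. (2 * n + 1) ^ (CARD('d) - 1)"]
    by simp
  have "card (cube_grid n :: (real ^ 'd) set) \<le> (\<Sum>j\<in>UNIV. card (\<Union>s\<in>{-1, 1}. ?g j s ` ?F j))"
    unfolding cube_grid_def by (rule card_UN_le) simp
  also have "\<dots> \<le> (\<Sum>j\<in>(UNIV :: 'd set). 2 * (2 * n + 1) ^ (CARD('d) - 1))"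
    by (intro sum_mono face)
  also have "\<dots> = 2 * CARD('d) * (2 * n + 1) ^ (CARD('d) - 1)" by simp
  finally show ?thesis .
qed

lemma norm_cube_grid_ge: "v \<in> cube_grid n \<Longrightarrow> 1 \<le> norm v"
proof -
  assume "v \<in> cube_grid n"
  then obtain j s f where "s \<in> {-1, 1}" and v: "v = (\<chi> i. if i = j then s else real_of_int (f i) / real n)"
    unfolding cube_grid_def by blast
  then have "\<bar>v $ j\<bar> = 1" by auto
  then show ?thesis using component_le_norm_cart[of v j] by simp
qed

text \<open>
  Dividing \<open>u\<close> by the modulus of its largest coordinate puts it on the boundary of the cube; rounding the other
  coordinates down moves each of them by at most \<open>1 / n\<close>.
\<close>

lemma cube_grid_cover:
  fixes u :: "real ^ 'd"
  assumes u: "u \<noteq> 0" and n: "0 < n"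
  obtains c v where "0 < c" "v \<in> cube_grid n" "norm (c *\<^sub>R u - v) \<le> real CARD('d) / real n"
proof -
  obtain j where j: "\<And>i. \<bar>u $ i\<bar> \<le> \<bar>u $ j\<bar>"
  proof -
    have "Max (range (\<lambda>i. \<bar>u $ i\<bar>)) \<in> range (\<lambda>i. \<bar>u $ i\<bar>)"
      by (intro Max_in) auto
    then obtain j where "Max (range (\<lambda>i. \<bar>u $ i\<bar>)) = \<bar>u $ j\<bar>" by (rule rangeE)
    then have "\<bar>u $ i\<bar> \<le> \<bar>u $ j\<bar>" for i
      by (metis Max_ge finite_imageI finite_class.finite_UNIV rangeI)
    then show ?thesis by (rule that)
  qed
  have uj: "\<bar>u $ j\<bar> > 0"
  proof (rule ccontr)
    assume "\<not> \<bar>u $ j\<bar> > 0"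
    then have "u $ i = 0" for i using j[of i] by simp
    then show False using u by (simp add: vec_eq_iff)
  qed
  define y where "y = (1 / \<bar>u $ j\<bar>) *\<^sub>R u"
  define s where "s = y $ j"
  have s: "s \<in> {-1, 1}" using uj by (auto simp: s_def y_def abs_if)
  have y: "\<bar>y $ i\<bar> \<le> 1" for i using uj j[of i] by (simp add: y_def abs_mult)
  define f where "f = (\<lambda>i\<in>UNIV - {j}. \<lfloor>real n * y $ i\<rfloor>)"
  have f: "f \<in> (\<Pi>\<^sub>E i\<in>UNIV - {j}. {- int n..int n})"
  proof -
    have "- real n \<le> real n * y $ i" "real n * y $ i \<le> real n" for i
    proof -
      have "\<bar>real n * y $ i\<bar> \<le> real n * 1"
        unfolding abs_mult using y[of i] by (intro mult_mono) auto
      then show "- real n \<le> real n * y $ i" "real n * y $ i \<le> real n" by (auto simp: abs_le_iff)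
    qed
    then have "- int n \<le> \<lfloor>real n * y $ i\<rfloor> \<and> \<lfloor>real n * y $ i\<rfloor> \<le> int n" for i
      by (simp add: le_floor_iff floor_le_iff) (smt (verit))
    then show ?thesis by (auto simp: f_def)
  qed
  define v :: "real ^ 'd" where "v = (\<chi> i. if i = j then s else real_of_int (f i) / real n)"
  have "v \<in> cube_grid n"
    unfolding cube_grid_def v_def using s f by blast
  moreover have "\<bar>(y - v) $ i\<bar> \<le> 1 / real n" for i
  proof (cases "i = j")
    case False
    have "\<bar>real n * y $ i - real_of_int \<lfloor>real n * y $ i\<rfloor>\<bar> \<le> 1" by linarith
    then have "\<bar>real n * y $ i - real_of_int \<lfloor>real n * y $ i\<rfloor>\<bar> / real n \<le> 1 / real n"
      using n by (intro divide_right_mono) auto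
    also have "\<bar>real n * y $ i - real_of_int \<lfloor>real n * y $ i\<rfloor>\<bar> / real n = \<bar>(y - v) $ i\<bar>"
    proof -
      have "(y - v) $ i = (real n * y $ i - real_of_int \<lfloor>real n * y $ i\<rfloor>) / real n"
        using False n by (simp add: v_def f_def diff_divide_distrib)
      then show ?thesis by simp
    qed
    finally show ?thesis .
  qed (simp add: v_def s_def)
  then have "norm (y - v) \<le> (\<Sum>i\<in>(UNIV :: 'd set). 1 / real n)"
    by (intro order_trans[OF norm_le_l1_cart] sum_mono)
  then have "norm ((1 / \<bar>u $ j\<bar>) *\<^sub>R u - v) \<le> real CARD('d) / real n"
    by (simp add: y_def)
  ultimately show ?thesis using uj by (intro that[of "1 / \<bar>u $ j\<bar>" v]) auto
qed

section \<open>Covering the image of the field\<close>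

text \<open>
  Trades a power for an exponential, whose moments factorise.
\<close>

lemma powr_le_exp:
  fixes x s :: real
  assumes "0 < s" "0 \<le> x"
  shows "x powr s \<le> s powr s * exp x"
proof -
  have "x / s \<le> exp (x / s)" using exp_ge_add_one_self[of "x / s"] by linarith
  then have "x \<le> s * exp (x / s)" using assms by (simp add: field_simps)
  then have "x powr s \<le> (s * exp (x / s)) powr s"
    using assms by (intro powr_mono2) auto
  also have "\<dots> = s powr s * exp (x / s) powr s"
    using assms by (simp add: powr_mult)
  also have "exp (x / s) powr s = exp x"
    using assms by (simp add: powr_def)
  finally show ?thesis .
qed

text \<open>
  The hyperplane orthogonal to \<open>x\<close> does not come within \<open>r\<close> of \<open>v\<close>, so \<open>u\<close> and \<open>v\<close> are on the same
  side of it.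
\<close>

lemma inner_pos_stable:
  fixes u v x :: "'a::euclidean_space"
  assumes "norm (u - v) \<le> r" "norm x = 1" "x \<notin> slab v r"
  shows "u \<bullet> x > 0 \<longleftrightarrow> v \<bullet> x > 0"
proof -
  have "\<bar>u \<bullet> x - v \<bullet> x\<bar> \<le> norm (u - v) * norm x"
    using Cauchy_Schwarz_ineq2[of "u - v" x] by (simp add: inner_diff_left)
  then have "\<bar>u \<bullet> x - v \<bullet> x\<bar> \<le> r" using assms by simp
  then show ?thesis using assms(3) by (auto simp: slab_def abs_if split: if_splits)
qed

text \<open>
  The hyperplanes that may cross the cell of radius \<open>CARD('d) / n\<close> around \<open>v\<close>, counted with weights.
\<close>

definition crossing_load :: "real \<Rightarrow> (nat \<Rightarrow> real ^ 'd) \<Rightarrow> nat \<Rightarrow> real ^ 'd \<Rightarrow> real" where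
  "crossing_load \<alpha> e n v =
     (\<Sum>k. crossing_weight \<alpha> n k * indicat_real (slab v (real CARD('d) / real n)) (e k))"

context
  fixes \<alpha> L :: real and t :: "nat \<Rightarrow> real" and e :: "nat \<Rightarrow> real ^ 'd"
  assumes \<alpha>: "0 < \<alpha>" "\<alpha> < 1"
    and gamma_nonneg: "\<And>k. 0 \<le> gamma_seq \<alpha> t k"
    and gamma_le: "\<And>k. gamma_seq \<alpha> t k \<le> L * real (Suc k) powr (- 1 / \<alpha>)"
    and norm_e: "\<And>k. norm (e k) = 1"
begin

lemma gamma_bound_nonneg: "0 \<le> L"
  using gamma_nonneg[of 0] gamma_le[of 0] by simp

lemma gamma_le_crossing_weight:
  assumes "0 < n" "n \<le> k"
  shows "gamma_seq \<alpha> t k \<le> L * real n powr (- 1 / \<alpha>) * crossing_weight \<alpha> n k"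
proof -
  have inv: "real n powr (- 1 / \<alpha>) * real n powr (1 / \<alpha>) = 1"
    using assms by (simp flip: powr_add)
  have "L * real n powr (- 1 / \<alpha>) * crossing_weight \<alpha> n k
      = L * (real n powr (- 1 / \<alpha>) * real n powr (1 / \<alpha>)) * real (Suc k) powr (- 1 / \<alpha>)"
    unfolding crossing_weight_late[OF \<alpha>(1) assms(2)] by (simp only: mult.assoc)
  also have "\<dots> = L * real (Suc k) powr (- 1 / \<alpha>)"
    by (simp only: inv mult_1_right)
  finally have eq: "L * real n powr (- 1 / \<alpha>) * crossing_weight \<alpha> n k = L * real (Suc k) powr (- 1 / \<alpha>)" .
  show ?thesis unfolding eq by (rule gamma_le)
qed

lemma summable_gamma_seq: "summable (gamma_seq \<alpha> t)"
proof (rule summable_comparison_test'[of _ 1])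
  show "summable (\<lambda>k. L * crossing_weight \<alpha> 1 k)"
    by (intro summable_mult summable_crossing_weight) (use \<alpha> in auto)
  show "norm (gamma_seq \<alpha> t k) \<le> L * crossing_weight \<alpha> 1 k" if "1 \<le> k" for k
    using gamma_le_crossing_weight[of 1 k] gamma_nonneg[of k] that by simp
qed

text \<open>
  The terms of the two series agree when \<open>e k\<close> is outside the slab, since then its hyperplane misses the
  cell, and for the first \<open>n\<close> indices by assumption. What remains are the late crossing jumps.
\<close>

lemma X_field_oscillation:
  assumes u: "norm (u - v) \<le> r" "norm (u' - v) \<le> r"
    and agree: "\<And>k. k < n \<Longrightarrow> e k \<in> slab v r \<Longrightarrow> u \<bullet> e k > 0 \<longleftrightarrow> u' \<bullet> e k > 0"
  shows "norm (X_field \<alpha> t e u - X_field \<alpha> t e u')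
    \<le> (\<Sum>k. gamma_seq \<alpha> t (k + n) * indicat_real (slab v r) (e (k + n)))"
proof -
  define D where "D k = indicat_real {x. u \<bullet> x > 0} (e k) *\<^sub>R gamma_seq \<alpha> t k *\<^sub>R e k
      - indicat_real {x. u' \<bullet> x > 0} (e k) *\<^sub>R gamma_seq \<alpha> t k *\<^sub>R e k" for k
  note summ = summable_X_field_terms[OF summable_gamma_seq gamma_nonneg norm_e]
  have D_outside: "D k = 0" if "e k \<notin> slab v r" for k
    using inner_pos_stable[OF u(1) norm_e that] inner_pos_stable[OF u(2) norm_e that]
    by (simp add: D_def indicator_def)
  have D_early: "D k = 0" if "k < n" for k
    using D_outside[of k] agree[OF that] by (cases "e k \<in> slab v r") (auto simp: D_def indicator_def)
  have D_le: "norm (D k) \<le> gamma_seq \<alpha> t k * indicat_real (slab v r) (e k)" for k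
    using D_outside[of k] gamma_nonneg[of k] norm_e[of k]
    by (cases "e k \<in> slab v r") (auto simp: D_def indicator_def)
  have summ_D: "summable D" unfolding D_def by (intro summable_diff summ)
  have "X_field \<alpha> t e u - X_field \<alpha> t e u' = suminf D"
    unfolding X_field_def D_def by (rule suminf_diff[OF summ summ])
  also have "\<dots> = (\<Sum>k. D (k + n))"
    using suminf_split_initial_segment[OF summ_D, of n] D_early by simp
  also have "norm \<dots> \<le> (\<Sum>k. gamma_seq \<alpha> t (k + n) * indicat_real (slab v r) (e (k + n)))"
  proof (rule norm_suminf_le[OF D_le])
    show "summable (\<lambda>k. gamma_seq \<alpha> t (k + n) * indicat_real (slab v r) (e (k + n)))"
      by (rule summable_comparison_test'[OF summable_ignore_initial_segment[OF summable_gamma_seq, of n], of 0])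
        (auto simp: indicator_def gamma_nonneg)
  qed
  finally show ?thesis .
qed

lemma summable_load: "0 < n \<Longrightarrow> summable (\<lambda>k. crossing_weight \<alpha> n k * indicat_real A (e k))"
  by (rule summable_comparison_test'[OF summable_crossing_weight[OF \<alpha>, of n], of 0])
    (auto simp: indicator_def crossing_weight_bounds)

text \<open>
  The cell around \<open>v\<close> is split according to the side on which a direction lies of each of the early
  (\<open>k < n\<close>) crossing hyperplanes. With \<open>m\<close> of them there are \<open>2 ^ m \<le> exp m\<close> pieces, and on each
  piece the field oscillates by at most \<open>c * tl v\<close>, where \<open>tl v\<close> is the weighted count of the late
  crossings. Since \<open>(tl v) powr s\<close> is at most a constant times \<open>exp (tl v)\<close>, the pieces of one cell
  contribute at most a constant times the exponential of the whole load.
\<close>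

lemma hausdorff_premeasure_closure_X_le:
  assumes n: "0 < n" and s: "0 < s" and tail: "(\<Sum>k. gamma_seq \<alpha> t (k + n)) \<le> \<delta>"
  shows "hausdorff_premeasure s \<delta> (closure (X_field \<alpha> t e ` sphere 0 1))
    \<le> ennreal ((L * s) powr s * (real n powr (- s / \<alpha>) * (\<Sum>v\<in>cube_grid n. exp (crossing_load \<alpha> e n v))))"
proof -
  define r where "r = real CARD('d) / real n"
  define K where "K v = {k \<in> {..<n}. e k \<in> slab v r}" for v
  define C where "C v J = {u. norm (u - v) \<le> r \<and> {k \<in> K v. u \<bullet> e k > 0} = J}" for v J
  define U where "U = (\<lambda>(v, J). closure (X_field \<alpha> t e ` C v J))"
  define tl where "tl v = (\<Sum>k. crossing_weight \<alpha> n (k + n) * indicat_real (slab v r) (e (k + n)))" for v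
  \<comment> \<open>The unit of length in which the weights measure the late jumps.\<close>
  define c where "c = L * real n powr (- 1 / \<alpha>)"
  let ?I = "Sigma (cube_grid n :: (real^'d) set) (\<lambda>v. Pow (K v))"
  have c0: "0 \<le> c" using gamma_bound_nonneg by (simp add: c_def)
  have finK: "finite (K v)" for v by (simp add: K_def)
  have sw: "summable (\<lambda>k. crossing_weight \<alpha> n k * indicat_real (slab v r) (e k))" for v
    by (rule summable_load[OF n])
  have tl0: "0 \<le> tl v" for v
    unfolding tl_def
    by (intro suminf_nonneg summable_ignore_initial_segment[OF sw]) (simp add: crossing_weight_bounds)
  have load: "crossing_load \<alpha> e n v = real (card (K v)) + tl v" for v
  proof -
    have "(\<Sum>k<n. crossing_weight \<alpha> n k * indicat_real (slab v r) (e k)) = (\<Sum>k<n. indicat_real (slab v r) (e k))"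
      by (intro sum.cong) (auto simp: crossing_weight_early \<alpha>)
    also have "\<dots> = real (card (K v))"
      by (simp add: K_def indicator_def of_bool_def flip: sum.inter_filter)
    finally show ?thesis
      using suminf_split_initial_segment[OF sw[of v], of n]
      by (simp add: crossing_load_def tl_def r_def)
  qed
  have cover: "closure (X_field \<alpha> t e ` sphere 0 1) \<subseteq> (\<Union>i\<in>?I. U i)"
  proof (rule closure_minimal)
    show "closed (\<Union>i\<in>?I. U i)"
      by (intro closed_UN finite_SigmaI finite_cube_grid) (auto simp: finK U_def)
    show "X_field \<alpha> t e ` sphere 0 1 \<subseteq> (\<Union>i\<in>?I. U i)"
    proof clarify
      fix u :: "real^'d" assume "u \<in> sphere 0 1"
      then have "u \<noteq> 0" by auto
      then obtain b v where b: "0 < b" "v \<in> cube_grid n" "norm (b *\<^sub>R u - v) \<le> r"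
        using cube_grid_cover[OF _ n] unfolding r_def by blast
      let ?J = "{k \<in> K v. (b *\<^sub>R u) \<bullet> e k > 0}"
      have "b *\<^sub>R u \<in> C v ?J" using b by (simp add: C_def)
      then have "X_field \<alpha> t e (b *\<^sub>R u) \<in> U (v, ?J)"
        unfolding U_def using closure_subset by fastforce
      then have "X_field \<alpha> t e u \<in> U (v, ?J)"
        by (simp only: X_field_scale[OF b(1)])
      moreover have "(v, ?J) \<in> ?I" using b(2) by auto
      ultimately show "X_field \<alpha> t e u \<in> (\<Union>i\<in>?I. U i)" by blast
    qed
  qed
  have osc: "norm (x - y) \<le> (\<Sum>k. gamma_seq \<alpha> t (k + n) * indicat_real (slab v r) (e (k + n)))"
    if xy: "x \<in> X_field \<alpha> t e ` C v J" "y \<in> X_field \<alpha> t e ` C v J" for x y v J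
  proof -
    obtain u u' where u: "u \<in> C v J" "x = X_field \<alpha> t e u" and u': "u' \<in> C v J" "y = X_field \<alpha> t e u'"
      using xy by blast
    have "{k \<in> K v. u \<bullet> e k > 0} = {k \<in> K v. u' \<bullet> e k > 0}"
      using u u' by (simp add: C_def)
    then have "u \<bullet> e k > 0 \<longleftrightarrow> u' \<bullet> e k > 0" if "k < n" "e k \<in> slab v r" for k
      using that by (auto simp: K_def)
    then show ?thesis
      unfolding u u' using u(1) u'(1) by (intro X_field_oscillation) (auto simp: C_def)
  qed
  have bdd: "bounded (X_field \<alpha> t e ` C v J)" for v J
    using norm_X_field_le[OF summable_gamma_seq gamma_nonneg, of e] norm_e
    by (intro boundedI[of _ "suminf (gamma_seq \<alpha> t)"]) auto
  have bdd_U: "bounded (U i)" for i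
    by (cases i) (simp add: U_def bounded_closure bdd)
  have summ_osc: "summable (\<lambda>k. gamma_seq \<alpha> t (k + n) * indicat_real (slab v r) (e (k + n)))" for v
    by (rule summable_comparison_test'[OF summable_ignore_initial_segment[OF summable_gamma_seq, of n], of 0])
      (auto simp: indicator_def gamma_nonneg)
  have osc0: "0 \<le> (\<Sum>k. gamma_seq \<alpha> t (k + n) * indicat_real (slab v r) (e (k + n)))" for v
    by (intro suminf_nonneg summ_osc) (simp add: gamma_nonneg)
  have diam: "diameter (U (v, J)) \<le> (\<Sum>k. gamma_seq \<alpha> t (k + n) * indicat_real (slab v r) (e (k + n)))" for v J
    unfolding U_def by (simp add: diameter_closure[OF bdd]) (intro diameter_le disjI2 osc osc0)
  have diam_\<delta>: "diameter (U (v, J)) \<le> \<delta>" for v J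
  proof (rule order_trans[OF diam order_trans[OF _ tail]])
    show "(\<Sum>k. gamma_seq \<alpha> t (k + n) * indicat_real (slab v r) (e (k + n))) \<le> (\<Sum>k. gamma_seq \<alpha> t (k + n))"
      by (intro suminf_le summ_osc summable_ignore_initial_segment summable_gamma_seq)
        (simp add: indicator_def gamma_nonneg)
  qed
  have diam_c: "diameter (U (v, J)) \<le> c * tl v" for v J
  proof (rule order_trans[OF diam])
    have "(\<Sum>k. gamma_seq \<alpha> t (k + n) * indicat_real (slab v r) (e (k + n)))
        \<le> (\<Sum>k. c * (crossing_weight \<alpha> n (k + n) * indicat_real (slab v r) (e (k + n))))"
      using gamma_le_crossing_weight[OF n] unfolding c_def
      by (intro suminf_le summ_osc summable_mult summable_ignore_initial_segment[OF sw])
        (auto simp: indicator_def)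
    also have "\<dots> = c * tl v"
      unfolding tl_def by (rule suminf_mult) (rule summable_ignore_initial_segment[OF sw])
    finally show "(\<Sum>k. gamma_seq \<alpha> t (k + n) * indicat_real (slab v r) (e (k + n))) \<le> c * tl v" .
  qed
  have diam_powr: "diameter (U (v, J)) powr s \<le> (c * s) powr s * exp (tl v)" for v J
  proof -
    have "diameter (U (v, J)) powr s \<le> (c * tl v) powr s"
      using s diam_c by (intro powr_mono2) (auto simp: U_def diameter_ge_0 bounded_closure bdd)
    also have "\<dots> = c powr s * tl v powr s" using c0 tl0 by (simp add: powr_mult)
    also have "\<dots> \<le> c powr s * (s powr s * exp (tl v))"
      by (intro mult_left_mono powr_le_exp s tl0) simp
    finally show ?thesis using c0 s by (simp add: powr_mult)
  qed
  have "hausdorff_premeasure s \<delta> (closure (X_field \<alpha> t e ` sphere 0 1))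
      \<le> (\<Sum>i\<in>?I. ennreal (diameter (U i) powr s))"
    by (rule hausdorff_premeasure_le_finite_cover[OF _ cover])
      (auto simp: finite_cube_grid finK diam_\<delta> bdd_U)
  also have "\<dots> = ennreal (\<Sum>i\<in>?I. diameter (U i) powr s)"
    by (rule sum_ennreal) simp
  also have "\<dots> \<le> ennreal ((c * s) powr s * (\<Sum>v\<in>cube_grid n. exp (crossing_load \<alpha> e n v)))"
  proof (rule ennreal_leI)
    have "(\<Sum>i\<in>?I. diameter (U i) powr s) = (\<Sum>v\<in>cube_grid n. \<Sum>J\<in>Pow (K v). diameter (U (v, J)) powr s)"
      by (subst sum.Sigma) (auto simp: finite_cube_grid finK)
    also have "\<dots> \<le> (\<Sum>v\<in>cube_grid n. (c * s) powr s * exp (crossing_load \<alpha> e n v))"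
    proof (rule sum_mono)
      fix v :: "real^'d"
      have "(\<Sum>J\<in>Pow (K v). diameter (U (v, J)) powr s) \<le> (\<Sum>J\<in>Pow (K v). (c * s) powr s * exp (tl v))"
        by (intro sum_mono diam_powr)
      also have "\<dots> = 2 ^ card (K v) * ((c * s) powr s * exp (tl v))"
        by (simp add: card_Pow finK)
      also have "\<dots> \<le> exp (real (card (K v))) * ((c * s) powr s * exp (tl v))"
      proof (rule mult_right_mono)
        have "(2::real) ^ card (K v) \<le> exp 1 ^ card (K v)"
          using exp_ge_add_one_self[of 1] by (intro power_mono) auto
        then show "2 ^ card (K v) \<le> exp (real (card (K v)))"
          by (simp flip: exp_of_nat_mult)
      qed simp
      also have "\<dots> = (c * s) powr s * exp (crossing_load \<alpha> e n v)"
        by (simp add: load exp_add)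
      finally show "(\<Sum>J\<in>Pow (K v). diameter (U (v, J)) powr s) \<le> (c * s) powr s * exp (crossing_load \<alpha> e n v)" .
    qed
    finally show "(\<Sum>i\<in>?I. diameter (U i) powr s) \<le> (c * s) powr s * (\<Sum>v\<in>cube_grid n. exp (crossing_load \<alpha> e n v))"
      by (simp add: sum_distrib_left)
  qed
  also have "(c * s) powr s = (L * s) powr s * real n powr (- s / \<alpha>)"
    using gamma_bound_nonneg s by (simp add: c_def powr_mult powr_powr mult_ac)
  finally show ?thesis by (simp only: mult.assoc)
qed

text \<open>
  For each \<open>\<delta>\<close> one good cover suffices, so covers along a subsequence with bounded sums are enough and
  the lower limit is the right quantity. The meshes \<open>\<delta>\<close> are reached because the tail sums of the jumps
  tend to 0.
\<close>

lemma hausdorff_measure_closure_X_finite: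
  assumes s: "0 < s"
    and fin: "liminf (\<lambda>n. ennreal (real (Suc n) powr (- s / \<alpha>)
        * (\<Sum>v\<in>cube_grid (Suc n). exp (crossing_load \<alpha> e (Suc n) v)))) < \<infinity>" (is "liminf ?Y < _")
  shows "hausdorff_measure s (closure (X_field \<alpha> t e ` sphere 0 1)) < \<infinity>" (is "hausdorff_measure s ?A < _")
proof -
  obtain B where B: "liminf ?Y < B" "B < \<infinity>"
    using fin dense by blast
  have "hausdorff_premeasure s \<delta> ?A \<le> ennreal ((L * s) powr s) * B" if \<delta>: "0 < \<delta>" for \<delta>
  proof -
    have "eventually (\<lambda>n. (\<Sum>k. gamma_seq \<alpha> t (k + n)) < \<delta>) sequentially"
      using order_tendstoD(2)[OF suminf_exist_split2[OF summable_gamma_seq] \<delta>] .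
    then have ev: "eventually (\<lambda>n. (\<Sum>k. gamma_seq \<alpha> t (k + Suc n)) < \<delta>) sequentially"
      by (rule eventually_compose_filterlim[OF _ filterlim_Suc])
    have "\<exists>\<^sub>F n in sequentially. ?Y n \<le> B"
    proof (rule ccontr)
      assume "\<not> ?thesis"
      then have "eventually (\<lambda>n. B \<le> ?Y n) sequentially"
        unfolding not_frequently by eventually_elim simp
      then have "B \<le> liminf ?Y" by (rule Liminf_bounded)
      with B(1) show False by simp
    qed
    then have "\<exists>\<^sub>F n in sequentially. ?Y n \<le> B \<and> (\<Sum>k. gamma_seq \<alpha> t (k + Suc n)) < \<delta>"
      using ev by (rule frequently_eventually_frequently)
    then obtain n where n: "?Y n \<le> B" "(\<Sum>k. gamma_seq \<alpha> t (k + Suc n)) < \<delta>"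
      by (blast dest: frequently_ex)
    have "hausdorff_premeasure s \<delta> ?A \<le> ennreal ((L * s) powr s * (real (Suc n) powr (- s / \<alpha>)
        * (\<Sum>v\<in>cube_grid (Suc n). exp (crossing_load \<alpha> e (Suc n) v))))"
      by (rule hausdorff_premeasure_closure_X_le) (use s n(2) in auto)
    also have "\<dots> = ennreal ((L * s) powr s) * ?Y n"
      by (rule ennreal_mult) (auto intro!: mult_nonneg_nonneg sum_nonneg)
    also have "\<dots> \<le> ennreal ((L * s) powr s) * B"
      by (intro mult_left_mono n(1)) simp
    finally show ?thesis .
  qed
  then have "hausdorff_measure s ?A \<le> ennreal ((L * s) powr s) * B"
    unfolding hausdorff_measure_eq_SUP by (intro SUP_least) auto
  also have "\<dots> < \<infinity>"
    using B(2) by (simp add: ennreal_mult_less_top)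
  finally show ?thesis .
qed

end

section \<open>Linear growth of the arrival times\<close>

lemma (in prob_space) nn_integral_exp_minus_exponential:
  assumes "distributed M lborel X (exponential_density 1)"
  shows "(\<integral>\<^sup>+\<omega>. ennreal (exp (- X \<omega>)) \<partial>M) = ennreal (1 / 2)"
proof -
  have "(\<integral>\<^sup>+\<omega>. ennreal (exp (- X \<omega>)) \<partial>M)
      = (\<integral>\<^sup>+x. ennreal (exponential_density 1 x) * ennreal (exp (- x)) \<partial>lborel)"
    by (rule distributed_nn_integral[OF assms, symmetric]) simp
  also have "\<dots> = (\<integral>\<^sup>+x. ennreal (1 / 2) * ennreal (exponential_density 2 x) \<partial>lborel)"
  proof (rule nn_integral_cong)
    fix x :: real
    have "exponential_density 1 x * exp (- x) = 1 / 2 * exponential_density 2 x"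
      by (simp add: exponential_density_def exp_add[symmetric])
    then show "ennreal (exponential_density 1 x) * ennreal (exp (- x))
        = ennreal (1 / 2) * ennreal (exponential_density 2 x)"
      by (subst (1 2) ennreal_mult[symmetric]) (auto intro: exponential_density_nonneg)
  qed
  also have "\<dots> = ennreal (1 / 2) * (\<integral>\<^sup>+x. ennreal (exponential_density 2 x) \<partial>lborel)"
    by (rule nn_integral_cmult) simp
  also have "(\<integral>\<^sup>+x. ennreal (exponential_density 2 x) \<partial>lborel) = 1"
  proof -
    interpret D: prob_space "density lborel (\<lambda>x. ennreal (exponential_density 2 x))"
      by (rule prob_space_exponential_density) simp
    show ?thesis using D.emeasure_space_1 by (simp add: emeasure_density)
  qed
  finally show ?thesis by simp
qed

text \<open>
  A substitute for the strong law of large numbers. Since \<open>exp (- \<Gamma>)\<close> has mean \<open>(1 / 2) ^ Suc k\<close> and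
  \<open>exp (1 / 2) < 2\<close>, the expectations of \<open>exp (Suc k / 2 - \<Gamma>)\<close> are summable. Hence almost surely these
  variables are bounded, that is, \<open>\<Gamma> \<ge> Suc k / 2 - b\<close> with a random \<open>b\<close>. Positivity of the first
  waiting time then allows the subtracted constant to be absorbed into the slope.
\<close>

lemma (in prob_space) AE_Gamma_seq_linear_growth:
  assumes \<tau>: "\<And>k. distributed M lborel (\<tau> k) (exponential_density 1)"
    and indep: "indep_vars (\<lambda>_. borel) \<tau> UNIV"
  shows "AE \<omega> in M. \<exists>c>0. \<forall>k. c * real (Suc k) \<le> Gamma_seq (\<lambda>k. \<tau> k \<omega>) k"
proof -
  have [measurable]: "\<tau> k \<in> borel_measurable M" for k
    using \<tau>[of k] by (simp add: distributed_def)
  let ?\<Gamma> = "\<lambda>\<omega>. Gamma_seq (\<lambda>k. \<tau> k \<omega>)"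
  have pos: "AE \<omega> in M. \<forall>k. 0 < \<tau> k \<omega>"
  proof (subst AE_all_countable, intro allI)
    fix k
    have "prob {\<omega> \<in> space M. 0 < \<tau> k \<omega>} = 1"
      using exponential_distributedD_gt[OF \<tau>[of k], of 0] by simp
    then show "AE \<omega> in M. 0 < \<tau> k \<omega>"
      using AE_in_set_eq_1[of "{\<omega> \<in> space M. 0 < \<tau> k \<omega>}"] by auto
  qed
  have laplace: "(\<integral>\<^sup>+\<omega>. ennreal (exp (- ?\<Gamma> \<omega> k)) \<partial>M) = ennreal ((1 / 2) ^ Suc k)" for k
  proof -
    have "(\<integral>\<^sup>+\<omega>. ennreal (exp (- ?\<Gamma> \<omega> k)) \<partial>M) = (\<integral>\<^sup>+\<omega>. (\<Prod>i\<le>k. ennreal (exp (- \<tau> i \<omega>))) \<partial>M)"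
      by (simp add: Gamma_seq_def exp_sum prod_ennreal flip: sum_negf)
    also have "\<dots> = (\<Prod>i\<le>k. \<integral>\<^sup>+\<omega>. ennreal (exp (- \<tau> i \<omega>)) \<partial>M)"
    proof (rule indep_vars_nn_integral)
      have "indep_vars (\<lambda>_. borel) \<tau> {..k}"
        by (rule indep_vars_subset[OF indep]) simp
      then show "indep_vars (\<lambda>_. borel) (\<lambda>i \<omega>. ennreal (exp (- \<tau> i \<omega>))) {..k}"
        by (rule indep_vars_compose2) measurable
    qed auto
    also have "\<dots> = (\<Prod>i\<le>k. ennreal (1 / 2))"
      by (simp only: nn_integral_exp_minus_exponential[OF \<tau>])
    also have "\<dots> = ennreal ((1 / 2) ^ Suc k)"
      by (simp only: prod_constant card_atMost ennreal_power divide_nonneg_nonneg zero_le_one zero_le_numeral)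
    finally show ?thesis .
  qed
  let ?V = "\<lambda>\<omega>. \<Sum>k. ennreal (exp (real (Suc k) / 2 - ?\<Gamma> \<omega> k))"
  have [measurable]: "(\<lambda>\<omega>. ?\<Gamma> \<omega> k) \<in> borel_measurable M" for k
    unfolding Gamma_seq_def by measurable
  have "(\<integral>\<^sup>+\<omega>. ?V \<omega> \<partial>M) = (\<Sum>k. \<integral>\<^sup>+\<omega>. ennreal (exp (real (Suc k) / 2 - ?\<Gamma> \<omega> k)) \<partial>M)"
    by (rule nn_integral_suminf) measurable
  also have "\<dots> = (\<Sum>k. ennreal ((exp (1 / 2) / 2) ^ Suc k))"
  proof (rule suminf_cong)
    fix k
    have "(\<integral>\<^sup>+\<omega>. ennreal (exp (real (Suc k) / 2 - ?\<Gamma> \<omega> k)) \<partial>M)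
        = (\<integral>\<^sup>+\<omega>. ennreal (exp (real (Suc k) / 2)) * ennreal (exp (- ?\<Gamma> \<omega> k)) \<partial>M)"
      by (intro nn_integral_cong) (simp add: ennreal_mult[symmetric] exp_add[symmetric])
    also have "\<dots> = ennreal (exp (real (Suc k) / 2)) * ennreal ((1 / 2) ^ Suc k)"
      by (subst nn_integral_cmult) (simp_all only: laplace, measurable)
    also have "\<dots> = ennreal (exp (real (Suc k) / 2) * (1 / 2) ^ Suc k)"
      by (rule ennreal_mult[symmetric]) simp_all
    also have "exp (real (Suc k) / 2) = exp (1 / 2) ^ Suc k"
      using exp_of_nat_mult[of "Suc k" "1 / 2 :: real"] by simp
    also have "exp (1 / 2) ^ Suc k * (1 / 2) ^ Suc k = (exp (1 / 2) / 2 :: real) ^ Suc k"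
      by (simp only: power_mult_distrib[symmetric] mult_1_right times_divide_eq_right)
    finally show "(\<integral>\<^sup>+\<omega>. ennreal (exp (real (Suc k) / 2 - ?\<Gamma> \<omega> k)) \<partial>M)
        = ennreal ((exp (1 / 2) / 2) ^ Suc k)" .
  qed
  also have "\<dots> < \<infinity>"
  proof -
    have "exp (1 / 2 :: real) < 2"
      using exp_bound[of "1 / 2 :: real"] by (simp add: power2_eq_square)
    then have "summable (\<lambda>k. (exp (1 / 2) / 2 :: real) ^ Suc k)"
      by (subst summable_Suc_iff) (intro summable_geometric, simp)
    then show ?thesis by (subst suminf_ennreal2) auto
  qed
  finally have "AE \<omega> in M. ?V \<omega> \<noteq> \<infinity>"
    by (intro nn_integral_PInf_AE) auto
  with pos show ?thesis
  proof eventually_elim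
    case (elim \<omega>)
    obtain V where V: "0 \<le> V" "?V \<omega> = ennreal V"
      using elim(2) by (cases "?V \<omega>") auto
    define b where "b = ln (1 + V)"
    have b0: "0 \<le> b" using V(1) by (simp add: b_def)
    have lower: "real (Suc k) / 2 - b \<le> ?\<Gamma> \<omega> k" for k
    proof -
      have "(\<Sum>k\<in>{k}. ennreal (exp (real (Suc k) / 2 - ?\<Gamma> \<omega> k))) \<le> ?V \<omega>"
        by (rule sum_le_suminf) auto
      then have "ennreal (exp (real (Suc k) / 2 - ?\<Gamma> \<omega> k)) \<le> ennreal V"
        unfolding V(2) by simp
      then have "exp (real (Suc k) / 2 - ?\<Gamma> \<omega> k) \<le> V"
        using V(1) by (simp add: ennreal_le_iff)
      also have "\<dots> \<le> exp b" using V(1) by (simp add: b_def)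
      finally show ?thesis by simp
    qed
    have first: "\<tau> 0 \<omega> \<le> ?\<Gamma> \<omega> k" for k
      unfolding Gamma_seq_def using elim(1) by (intro member_le_sum) (auto intro: less_imp_le)
    have \<tau>0: "0 < \<tau> 0 \<omega>" using elim(1) by simp
    \<comment> \<open>As \<open>\<tau> 0 \<omega> \<le> \<Gamma>\<close>, one has \<open>\<Gamma> + b \<le> \<Gamma> * (1 + b / \<tau> 0 \<omega>)\<close>; this is the slope that results.\<close>
    define c where "c = \<tau> 0 \<omega> / (2 * (\<tau> 0 \<omega> + b))"
    have "c * real (Suc k) \<le> ?\<Gamma> \<omega> k" for k
    proof -
      have "\<tau> 0 \<omega> * (real (Suc k) / 2) \<le> \<tau> 0 \<omega> * (?\<Gamma> \<omega> k + b)"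
      proof (rule mult_left_mono)
        show "real (Suc k) / 2 \<le> ?\<Gamma> \<omega> k + b" using lower[of k] by linarith
      qed (use \<tau>0 in simp)
      also have "\<dots> \<le> \<tau> 0 \<omega> * ?\<Gamma> \<omega> k + b * ?\<Gamma> \<omega> k"
        using mult_left_mono[OF first[of k] b0] by (simp add: algebra_simps)
      finally show ?thesis
        using \<tau>0 b0 by (simp add: c_def field_simps)
    qed
    moreover have "0 < c" using \<tau>0 b0 by (simp add: c_def)
    ultimately show ?case by blast
  qed
qed

section \<open>Almost sure finiteness\<close>

text \<open>
  Each slab has probability of order \<open>1 / n\<close>, while the weights add up to order \<open>n\<close>; the bound does not
  depend on \<open>n\<close>.
\<close>

lemma (in prob_space) nn_integral_exp_crossing_load:
  fixes \<epsilon> :: "nat \<Rightarrow> 'a \<Rightarrow> real ^ 'd"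
  assumes \<alpha>: "0 < \<alpha>" "\<alpha> < 1" and n: "0 < n" and v: "1 \<le> norm v"
    and unif: "\<And>k. uniform_on_unit_sphere (distr M borel (\<epsilon> k))"
    and indep: "indep_vars (\<lambda>_. borel) \<epsilon> UNIV"
  shows "(\<integral>\<^sup>+\<omega>. ennreal (exp (crossing_load \<alpha> (\<lambda>k. \<epsilon> k \<omega>) n v)) \<partial>M)
    \<le> ennreal (exp (12 * 2 ^ CARD('d) * real CARD('d) / (1 - \<alpha>)))"
proof -
  let ?r = "real CARD('d) / real n"
  have [measurable]: "\<epsilon> k \<in> borel_measurable M" for k
    using indep by (simp add: indep_vars_def)
  have "prob {\<omega> \<in> space M. \<epsilon> k \<omega> \<in> slab v ?r} \<le> 6 * 2 ^ CARD('d) * ?r" for k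
  proof -
    have "prob {\<omega> \<in> space M. \<epsilon> k \<omega> \<in> slab v ?r} = measure (distr M borel (\<epsilon> k)) (slab v ?r)"
      by (subst measure_distr) (auto intro!: arg_cong[where f=prob])
    also have "\<dots> \<le> 6 * 2 ^ CARD('d) * ?r"
      by (rule uniform_on_unit_sphere_slab[OF unif v]) (use n in simp)
    finally show ?thesis .
  qed
  then have "(\<integral>\<^sup>+\<omega>. ennreal (exp (crossing_load \<alpha> (\<lambda>k. \<epsilon> k \<omega>) n v)) \<partial>M)
      \<le> ennreal (exp (2 * (6 * 2 ^ CARD('d) * ?r) * (real n / (1 - \<alpha>))))"
    unfolding crossing_load_def
    by (intro nn_integral_exp_weighted_hits indep slab_measurable crossing_weight_bounds
        summable_crossing_weight[OF \<alpha> n] suminf_le_const sum_crossing_weight_le[OF \<alpha> n])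
  also have "2 * (6 * 2 ^ CARD('d) * ?r) * (real n / (1 - \<alpha>)) = 12 * 2 ^ CARD('d) * real CARD('d) / (1 - \<alpha>)"
    using n by simp
  finally show ?thesis .
qed

text \<open>
  There are of order \<open>n ^ (d - 1)\<close> cells, each with a bounded exponential moment, and the normalising
  factor is the inverse of their number up to a constant. So the expectations stay bounded, and by
  Fatou's lemma the lower limit is integrable.
\<close>

lemma (in prob_space) AE_liminf_crossing_load_sum_finite:
  fixes \<epsilon> :: "nat \<Rightarrow> 'a \<Rightarrow> real ^ 'd"
  assumes \<alpha>: "0 < \<alpha>" "\<alpha> < 1"
    and unif: "\<And>k. uniform_on_unit_sphere (distr M borel (\<epsilon> k))"
    and indep: "indep_vars (\<lambda>_. borel) \<epsilon> UNIV"
  shows "AE \<omega> in M. liminf (\<lambda>n. ennreal (real (Suc n) powr - real (CARD('d) - 1)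
      * (\<Sum>v\<in>cube_grid (Suc n). exp (crossing_load \<alpha> (\<lambda>k. \<epsilon> k \<omega>) (Suc n) v)))) < \<infinity>"
proof -
  let ?d = "CARD('d)"
  define E where "E = exp (12 * 2 ^ ?d * real ?d / (1 - \<alpha>))"
  \<comment> \<open>\<open>Suc n\<close> instead of \<open>n\<close>, since the mesh \<open>1 / n\<close> is only meaningful for positive \<open>n\<close>.\<close>
  define Y where "Y n \<omega> = ennreal (real (Suc n) powr - real (?d - 1)
      * (\<Sum>v\<in>cube_grid (Suc n). exp (crossing_load \<alpha> (\<lambda>k. \<epsilon> k \<omega>) (Suc n) v)))" for n \<omega>
  have [measurable]: "\<epsilon> k \<in> borel_measurable M" for k
    using indep by (simp add: indep_vars_def)
  have load_meas [measurable]: "(\<lambda>\<omega>. crossing_load \<alpha> (\<lambda>k. \<epsilon> k \<omega>) n v) \<in> borel_measurable M" for n v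
    unfolding crossing_load_def by measurable
  have Y_meas [measurable]: "Y n \<in> borel_measurable M" for n
    unfolding Y_def by measurable
  have Y_le: "(\<integral>\<^sup>+\<omega>. Y n \<omega> \<partial>M) \<le> ennreal (2 * real ?d * 3 ^ (?d - 1) * E)" for n
  proof -
    let ?N = "real (Suc n)"
    let ?p = "?N powr - real (?d - 1)"
    let ?G = "cube_grid (Suc n) :: (real ^ 'd) set"
    have "(\<integral>\<^sup>+\<omega>. Y n \<omega> \<partial>M)
        = (\<integral>\<^sup>+\<omega>. ennreal ?p * (\<Sum>v\<in>?G. ennreal (exp (crossing_load \<alpha> (\<lambda>k. \<epsilon> k \<omega>) (Suc n) v))) \<partial>M)"
      unfolding Y_def by (intro nn_integral_cong) (subst ennreal_mult, auto simp: sum_nonneg)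
    also have "\<dots> = ennreal ?p * (\<Sum>v\<in>?G. \<integral>\<^sup>+\<omega>. ennreal (exp (crossing_load \<alpha> (\<lambda>k. \<epsilon> k \<omega>) (Suc n) v)) \<partial>M)"
      by (subst nn_integral_cmult, measurable, subst nn_integral_sum) simp_all
    also have "\<dots> \<le> ennreal ?p * (\<Sum>v\<in>?G. ennreal E)"
      unfolding E_def
      by (intro mult_left_mono sum_mono nn_integral_exp_crossing_load \<alpha> unif indep norm_cube_grid_ge) auto
    also have "\<dots> = ennreal (?p * (real (card ?G) * E))"
      by (simp add: E_def ennreal_mult ennreal_of_nat_eq_real_of_nat)
    also have "\<dots> \<le> ennreal (?p * (2 * real ?d * (3 * ?N) ^ (?d - 1) * E))"
    proof (intro ennreal_leI mult_left_mono mult_right_mono)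
      have "real (card ?G) \<le> real (2 * ?d * (2 * Suc n + 1) ^ (?d - 1))"
        by (rule of_nat_mono[OF card_cube_grid_le])
      also have "\<dots> = 2 * real ?d * real (2 * Suc n + 1) ^ (?d - 1)" by simp
      also have "\<dots> \<le> 2 * real ?d * (3 * ?N) ^ (?d - 1)"
        by (intro mult_left_mono power_mono) auto
      finally show "real (card ?G) \<le> 2 * real ?d * (3 * ?N) ^ (?d - 1)" .
    qed (auto simp: E_def)
    also have "?p * (2 * real ?d * (3 * ?N) ^ (?d - 1) * E) = (?p * ?N ^ (?d - 1)) * (2 * real ?d * 3 ^ (?d - 1) * E)"
      by (simp only: power_mult_distrib mult_ac)
    also have "?p * ?N ^ (?d - 1) = 1"
    proof -
      have cancel: "x powr - real m * x ^ m = 1" if "0 < x" for x :: real and m :: nat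
        using that by (simp add: powr_minus powr_realpow)
      show ?thesis by (rule cancel) simp
    qed
    finally show ?thesis by simp
  qed
  have "(\<integral>\<^sup>+\<omega>. liminf (\<lambda>n. Y n \<omega>) \<partial>M) \<le> liminf (\<lambda>n. \<integral>\<^sup>+\<omega>. Y n \<omega> \<partial>M)"
    by (rule nn_integral_liminf) measurable
  also have "\<dots> \<le> limsup (\<lambda>n. \<integral>\<^sup>+\<omega>. Y n \<omega> \<partial>M)"
    by (rule Liminf_le_Limsup) simp
  also have "\<dots> \<le> ennreal (2 * real ?d * 3 ^ (?d - 1) * E)"
    by (intro Limsup_bounded always_eventually allI Y_le)
  finally have "(\<integral>\<^sup>+\<omega>. liminf (\<lambda>n. Y n \<omega>) \<partial>M) \<noteq> \<infinity>"
    by (auto simp: top_unique)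
  then have "AE \<omega> in M. liminf (\<lambda>n. Y n \<omega>) \<noteq> \<infinity>"
    by (intro nn_integral_PInf_AE) measurable
  then show ?thesis
    unfolding Y_def by eventually_elim (simp add: less_top)
qed

lemma (in prob_space) AE_gamma_seq_power_bound:
  assumes \<tau>: "\<And>k. distributed M lborel (\<tau> k) (exponential_density 1)"
    and indep: "indep_vars (\<lambda>_. borel) \<tau> UNIV" and \<alpha>: "0 < \<alpha>"
  shows "AE \<omega> in M. \<exists>L. \<forall>k. gamma_seq \<alpha> (\<lambda>k. \<tau> k \<omega>) k \<le> L * real (Suc k) powr (- 1 / \<alpha>)"
  using AE_Gamma_seq_linear_growth[OF \<tau> indep]
proof eventually_elim
  case (elim \<omega>)
  then obtain c where c: "0 < c" "\<And>k. c * real (Suc k) \<le> Gamma_seq (\<lambda>k. \<tau> k \<omega>) k" by blast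
  have "gamma_seq \<alpha> (\<lambda>k. \<tau> k \<omega>) k \<le> c powr (- 1 / \<alpha>) * real (Suc k) powr (- 1 / \<alpha>)" for k
  proof -
    have "gamma_seq \<alpha> (\<lambda>k. \<tau> k \<omega>) k \<le> (c * real (Suc k)) powr (- 1 / \<alpha>)"
      unfolding gamma_seq_def using c \<alpha> by (intro powr_mono2') auto
    also have "\<dots> = c powr (- 1 / \<alpha>) * real (Suc k) powr (- 1 / \<alpha>)"
      by (rule powr_mult)
    finally show ?thesis .
  qed
  then show ?case by blast
qed

lemma AE_norm_eq_1:
  fixes X :: "'w \<Rightarrow> 'a::euclidean_space"
  assumes "uniform_on_unit_sphere (distr M borel X)" and X: "X \<in> borel_measurable M"
  shows "AE \<omega> in M. norm (X \<omega>) = 1"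
proof -
  interpret D: prob_space "distr M borel X"
    using assms by (simp add: uniform_on_unit_sphere_def)
  have "AE x in distr M borel X. x \<in> sphere 0 1"
    using assms by (intro D.AE_in_set_eq_1[THEN iffD2])
      (auto simp: uniform_on_unit_sphere_def D.emeasure_eq_measure)
  then show ?thesis
    by (subst (asm) AE_distr_iff) (use X in auto)
qed

theorem corollary6p2:
  fixes M :: "'w measure"
    and \<tau> :: "nat \<Rightarrow> 'w \<Rightarrow> real"
    and \<epsilon> :: "nat \<Rightarrow> 'w \<Rightarrow> real ^ 'd"
    and \<alpha> :: real
  assumes "CARD('d) \<ge> 2" and "0 < \<alpha>" and "\<alpha> < 1"
    and "prob_space M"
    and "\<And>k. distributed M lborel (\<tau> k) (exponential_density 1)"
    and "\<And>k. \<epsilon> k \<in> borel_measurable M"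
    and "\<And>k. uniform_on_unit_sphere (distr M borel (\<epsilon> k))"
    and "prob_space.indep_vars M (\<lambda>_. borel) \<tau> UNIV"
    and "prob_space.indep_vars M (\<lambda>_. borel) \<epsilon> UNIV"
    and "prob_space.indep_set M
           (sets (vimage_algebra (space M) (\<lambda>\<omega> k. \<tau> k \<omega>) (\<Pi>\<^sub>M k\<in>UNIV. borel)))
           (sets (vimage_algebra (space M) (\<lambda>\<omega> k. \<epsilon> k \<omega>) (\<Pi>\<^sub>M k\<in>UNIV. borel)))"
  shows "(AE \<omega> in M. hausdorff_measure (real (CARD('d) - 1) * \<alpha>)
            (closure (X_field \<alpha> (\<lambda>k. \<tau> k \<omega>) (\<lambda>k. \<epsilon> k \<omega>) ` sphere 0 1)) < \<infinity>)
       \<and> (AE \<omega> in M. hausdorff_measure (real (CARD('d) - 1) * \<alpha>)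
            (F_extreme \<alpha> (\<lambda>k. \<tau> k \<omega>) (\<lambda>k. \<epsilon> k \<omega>)) < \<infinity>)"
proof -
  interpret prob_space M by fact
  let ?s = "real (CARD('d) - 1) * \<alpha>"
  have s: "0 < ?s" using assms(1,2) by simp
  have exponent: "- ?s / \<alpha> = - real (CARD('d) - 1)" using assms(2) by simp
  have "AE \<omega> in M. \<forall>k. norm (\<epsilon> k \<omega>) = 1"
    by (subst AE_all_countable) (intro allI AE_norm_eq_1 assms)
  then have "AE \<omega> in M.
      hausdorff_measure ?s (closure (X_field \<alpha> (\<lambda>k. \<tau> k \<omega>) (\<lambda>k. \<epsilon> k \<omega>) ` sphere 0 1)) < \<infinity>
      \<and> F_extreme \<alpha> (\<lambda>k. \<tau> k \<omega>) (\<lambda>k. \<epsilon> k \<omega>)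
          \<subseteq> closure (X_field \<alpha> (\<lambda>k. \<tau> k \<omega>) (\<lambda>k. \<epsilon> k \<omega>) ` sphere 0 1)"
    using AE_gamma_seq_power_bound[OF assms(5,8,2)]
      AE_liminf_crossing_load_sum_finite[OF assms(2,3,7,9)]
  proof eventually_elim
    case (elim \<omega>)
    let ?t = "\<lambda>k. \<tau> k \<omega>" and ?e = "\<lambda>k. \<epsilon> k \<omega>"
    have nonneg: "0 \<le> gamma_seq \<alpha> ?t k" for k by (simp add: gamma_seq_def)
    obtain L where L: "\<And>k. gamma_seq \<alpha> ?t k \<le> L * real (Suc k) powr (- 1 / \<alpha>)"
      using elim(2) by blast
    have norm_e: "norm (?e k) = 1" for k using elim(1) by blast
    show ?case
    proof
      show "hausdorff_measure ?s (closure (X_field \<alpha> ?t ?e ` sphere 0 1)) < \<infinity>"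
      proof (rule hausdorff_measure_closure_X_finite[OF assms(2,3) nonneg L norm_e s])
        show "liminf (\<lambda>n. ennreal (real (Suc n) powr (- ?s / \<alpha>)
            * (\<Sum>v\<in>cube_grid (Suc n). exp (crossing_load \<alpha> ?e (Suc n) v)))) < \<infinity>"
          unfolding exponent by (rule elim(3))
      qed
      show "F_extreme \<alpha> ?t ?e \<subseteq> closure (X_field \<alpha> ?t ?e ` sphere 0 1)"
        by (rule F_extreme_subset_closure[OF summable_gamma_seq[OF assms(2,3) nonneg L norm_e] nonneg norm_e])
    qed
  qed
  then have ae: "AE \<omega> in M.
      hausdorff_measure ?s (closure (X_field \<alpha> (\<lambda>k. \<tau> k \<omega>) (\<lambda>k. \<epsilon> k \<omega>) ` sphere 0 1)) < \<infinity>
      \<and> hausdorff_measure ?s (F_extreme \<alpha> (\<lambda>k. \<tau> k \<omega>) (\<lambda>k. \<epsilon> k \<omega>)) < \<infinity>"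
  proof eventually_elim
    case (elim \<omega>)
    then show ?case
      using le_less_trans[OF hausdorff_measure_mono] by blast
  qed
  show ?thesis
  proof
    show "AE \<omega> in M. hausdorff_measure ?s
        (closure (X_field \<alpha> (\<lambda>k. \<tau> k \<omega>) (\<lambda>k. \<epsilon> k \<omega>) ` sphere 0 1)) < \<infinity>"
      using ae by eventually_elim (rule conjunct1)
    show "AE \<omega> in M. hausdorff_measure ?s (F_extreme \<alpha> (\<lambda>k. \<tau> k \<omega>) (\<lambda>k. \<epsilon> k \<omega>)) < \<infinity>"
      using ae by eventually_elim (rule conjunct2)
  qed
qed

end
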